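(* Let $p\in[0,1]$ with $pn\in\mathbb{N}$. Let $B$ be a bid-velocity multi-set with $n$ bids (with two velocities) and $B^\gamma$ its $\gamma$-discretized version. Denote by $q_t,b_i(t)$ and $q^\gamma_t,b^\gamma_i(t)$ the max-price and the $i$-th bid of the continuous evolution $\mathcal{T}_tB$ and of the rescaled discrete evolution $T^\gamma_tB^\gamma$, respectively. Then $$\sup_{\gamma\in(0,1)}\sup_{t\ge0}\frac1\gamma|b^\gamma_i(t)-b_i(t)|<\infty\quad\text{for all }i=1,\dots,n,\qquad \sup_{\gamma\in(0,1)}\sup_{t\ge0}\frac1\gamma|q^\gamma_t-q_t|<\infty .$$
   Context: Let $0<\nu_-<\nu_+$ be natural numbers and $B=[(b_1,v_1),\dots,(b_n,v_n)]$ with $b_1\le\dots\le b_n$ in $[0,1]$ and $v_i\in\{\nu_-,\nu_+\}$. Each bid keeps its original velocity parameter throughout the dynamics. Continuous evolution. $\mathcal{T}_tB=B_t=[(b_1(t),v_1),\dots,(b_n(t),v_n)]$, with max-price $q_t$, is the unique solution of the following system, where $b_i(t)$ is the (reordered) position at time $t$ of the $i$-th bid. Let $F_t(x)=\frac1n\sum_{i=1}^n\mathbf{1}\{b_i(t)\le x\}$, $q_t=F_t^{-1}(p)=\inf\{x\ge0:F_t(x)\ge p\}$, $w_t=p-F_t(q_t^-)$ (with $F_t(x^-)$ the left limit), $\ell_t=F_t(q_t)-p$, $$h_t=\frac{w_t+\ell_t}{\frac1n\sum_{i=1}^n\frac1{v_i}\mathbf{1}\{b_i(t)=q_t\}},\qquad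 m^\pm_t=\frac1n\sum_{i=1}^n\mathbf{1}\{b_i(t)=q_t\}\mathbf{1}\{v_i=\nu_\pm\},$$ $$u_t=\begin{cases}\dfrac{w_t-\ell_t}{w_t+\ell_t}\,h_t & \text{if }\Bigl|\dfrac{w_t-\ell_t}{w_t+\ell_t}\,h_t\Bigr|\le\nu_-,\\[3mm] \dfrac{w_t-\ell_t-\operatorname{sign}(w_t-\ell_t)\,m^-_t}{m^+_t}\,\nu_+ & \text{if }\Bigl|\dfrac{w_t-\ell_t}{w_t+\ell_t}\,h_t\Bigr|>\nu_-,\end{cases}$$ $$\frac{dq_t}{dt}=u_t\,\mathbf{1}\{q_t\in(0,1)\},\qquad \frac{db_i(t)}{dt}=\begin{cases}+v_i & \text{if } b_i(t)<q_t,\\ u_t & \text{if } b_i(t)=q_t \text{ and } |u_t|\le v_i,\\ \operatorname{sign}(u_t)\,v_i & \text{if } b_i(t)=q_t \text{ and } |u_t|>v_i,\\ -v_i & \text{if } b_i(t)>q_t,\end{cases}$$ with initial condition $(q_0,B_0)=(b_{np},B)$. Discrete evolution. Let $\gamma$ be the inverse of a natural number and $B^\gamma=[(b^\gamma_1,v_1),\dots,(b^\gamma_n,v_n)]$ with $b^\gamma_i=\gamma\lfloor b_i/\gamma\rfloor$. One step $T^\gamma$ acts on a bid-velocity multi-set with ordered bids by moving each of the first $np$ bidders (winners) from $(b,v)$ to $(b+\gamma v,v)$ and each of the others (losers) from $(b,v)$ to $(b-\gamma v,v)$, with bids kept in $[0,1]$, and then reordering the pairs by a permutation that makes the bids nondecreasing;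 each bidder keeps its velocity after the reordering. Put $T^\gamma_t=(T^\gamma)^{\lfloor t/\gamma\rfloor}$; the max-price $q^\gamma_t$ is the $np$-th bid in increasing order of $T^\gamma_tB^\gamma$, and $b^\gamma_i(t)$ is the $i$-th bid of $T^\gamma_tB^\gamma$.
   Formalization: In the continuous evolution, the velocity of a bid at 0 or 1 is replaced by 0 when it points out of [0,1]; the displayed equation for b_i(t) has no such rule and then contradicts the price equation (e.g. n=1, p=1, b_1=1). *)

theory Defs
  imports "HOL-Analysis.Analysis"
begin

text \<open>
  A bid-velocity multi-set is represented by a list of pairs (bid, velocity). All quantities
  of the dynamics at a given time depend on the list only through its multiset of entries, so the
  list order carries nothing but the identity of the bidders.
\<close>

type_synonym bids = "(real \<times> nat) list"

definition bid_velocity_multiset :: "nat \<Rightarrow> nat \<Rightarrow> bids \<Rightarrow> bool" where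
  "bid_velocity_multiset \<nu>m \<nu>p B \<longleftrightarrow>
     B \<noteq> [] \<and> sorted (map fst B) \<and> (\<forall>(b, v) \<in> set B. b \<in> {0..1} \<and> v \<in> {\<nu>m, \<nu>p})"

text \<open>
  The \<open>i\<close>-th bid in increasing order, counted from 1. The value 0 for \<open>i = 0\<close> is a convention
  which only matters for \<open>p = 0\<close>, where it agrees with the quantile
  \<open>F\<^sup>-\<^sup>1(0) = inf {x \<ge> 0. F x \<ge> 0} = 0\<close>.
\<close>

definition nth_bid :: "bids \<Rightarrow> nat \<Rightarrow> real" where
  "nth_bid L i = (if i = 0 then 0 else sort (map fst L) ! (i - 1))"

text \<open>The number \<open>np\<close>; only used when \<open>np\<close> is a natural number.\<close>

definition num_winners :: "real \<Rightarrow> bids \<Rightarrow> nat" where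
  "num_winners p B = nat \<lfloor>p * real (length B)\<rfloor>"


section \<open>Continuous evolution\<close>

definition cdf :: "bids \<Rightarrow> real \<Rightarrow> real" where
  "cdf L x = 1 / real (length L) * (\<Sum>i<length L. of_bool (fst (L ! i) \<le> x))"

definition price :: "real \<Rightarrow> bids \<Rightarrow> real" where
  "price p L = Inf {x. 0 \<le> x \<and> p \<le> cdf L x}"

definition winning_mass :: "real \<Rightarrow> bids \<Rightarrow> real" where
  "winning_mass p L = p - Lim (at_left (price p L)) (cdf L)"

definition losing_mass :: "real \<Rightarrow> bids \<Rightarrow> real" where
  "losing_mass p L = cdf L (price p L) - p"

definition mean_velocity :: "real \<Rightarrow> bids \<Rightarrow> real" where
  "mean_velocity p L =
     (winning_mass p L + losing_mass p L) /
     (1 / real (length L) *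
       (\<Sum>i<length L. 1 / real (snd (L ! i)) * of_bool (fst (L ! i) = price p L)))"

definition tied_mass :: "real \<Rightarrow> bids \<Rightarrow> nat \<Rightarrow> real" where
  "tied_mass p L \<nu> =
     1 / real (length L) *
       (\<Sum>i<length L. of_bool (fst (L ! i) = price p L) * of_bool (snd (L ! i) = \<nu>))"

definition price_velocity :: "nat \<Rightarrow> nat \<Rightarrow> real \<Rightarrow> bids \<Rightarrow> real" where
  "price_velocity \<nu>m \<nu>p p L =
     (let w = winning_mass p L; l = losing_mass p L; u = (w - l) / (w + l) * mean_velocity p L
      in if \<bar>u\<bar> \<le> real \<nu>m then u
         else (w - l - sgn (w - l) * tied_mass p L \<nu>m) / tied_mass p L \<nu>p * real \<nu>p)"

definition bid_velocity :: "nat \<Rightarrow> nat \<Rightarrow> real \<Rightarrow> bids \<Rightarrow> real \<Rightarrow> nat \<Rightarrow> real" where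
  "bid_velocity \<nu>m \<nu>p p L b v =
     (let q = price p L; u = price_velocity \<nu>m \<nu>p p L
      in if b < q then real v
         else if b > q then - real v
         else if \<bar>u\<bar> \<le> real v then u
         else sgn u * real v)"

text \<open>
  Bids live in \<open>[0, 1]\<close>: a bid sitting at an end point of the interval does not move outwards.
  This only concerns bids tied with the price at 0 or 1, and corresponds to the indicator of
  \<open>q \<in> (0, 1)\<close> in the equation for the price (and to the truncation in the discrete evolution).
\<close>

definition confined :: "real \<Rightarrow> real \<Rightarrow> real" where
  "confined b g = (if b = 0 \<and> g < 0 \<or> b = 1 \<and> g > 0 then 0 else g)"

text \<open>
  \<open>X t ! i\<close> is the pair of the bidder who was at position \<open>i\<close> initially; it keeps its
  velocity parameter, while the bids of different bidders may cross. The \<open>i\<close>-th bid of the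
  evolution at time \<open>t\<close> is \<open>nth_bid (X t) i\<close>, i.e. taken after reordering. Since the right-hand
  side is discontinuous in the state, the differential equations are understood in the sense of
  Caratheodory: absolutely continuous functions satisfying them for almost every \<open>t\<close>. As the
  right-hand side is bounded by \<open>\<nu>p\<close>, absolutely continuous amounts to Lipschitz here.
\<close>

definition continuous_evolution :: "nat \<Rightarrow> nat \<Rightarrow> real \<Rightarrow> bids \<Rightarrow> (real \<Rightarrow> bids) \<Rightarrow> bool" where
  "continuous_evolution \<nu>m \<nu>p p B X \<longleftrightarrow>
     X 0 = B \<and> price p (X 0) = nth_bid B (num_winners p B) \<and>
     (\<forall>t\<ge>0. map snd (X t) = map snd B \<and> fst ` set (X t) \<subseteq> {0..1}) \<and>
     (\<forall>i<length B. \<exists>C. C-lipschitz_on {0..} (\<lambda>t. fst (X t ! i))) \<and>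
     (AE t in lborel. 0 < t \<longrightarrow>
        ((\<lambda>s. price p (X s)) has_real_derivative
           price_velocity \<nu>m \<nu>p p (X t) * of_bool (price p (X t) \<in> {0<..<1})) (at t) \<and>
        (\<forall>i<length B.
           ((\<lambda>s. fst (X s ! i)) has_real_derivative
              confined (fst (X t ! i))
                (bid_velocity \<nu>m \<nu>p p (X t) (fst (X t ! i)) (snd (X t ! i)))) (at t)))"


section \<open>Discrete evolution\<close>

definition discretize :: "real \<Rightarrow> bids \<Rightarrow> bids" where
  "discretize \<gamma> B = map (\<lambda>(b, v). (\<gamma> * of_int \<lfloor>b / \<gamma>\<rfloor>, v)) B"

definition clip :: "real \<Rightarrow> real" where
  "clip b = max 0 (min 1 b)"

definition move_bids :: "nat \<Rightarrow> real \<Rightarrow> bids \<Rightarrow> bids" where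
  "move_bids m \<gamma> L =
     map (\<lambda>(b, v). (clip (b + \<gamma> * real v), v)) (take m L) @
     map (\<lambda>(b, v). (clip (b - \<gamma> * real v), v)) (drop m L)"

text \<open>
  The reordering is only determined up to the order of pairs with equal bids and different
  velocities, which influences the further evolution; hence a step is a relation, and an evolution
  may break ties in any way.
\<close>

definition discrete_step :: "nat \<Rightarrow> real \<Rightarrow> bids \<Rightarrow> bids \<Rightarrow> bool" where
  "discrete_step m \<gamma> L L' \<longleftrightarrow> mset L' = mset (move_bids m \<gamma> L) \<and> sorted (map fst L')"

definition discrete_evolution :: "nat \<Rightarrow> real \<Rightarrow> bids \<Rightarrow> (nat \<Rightarrow> bids) \<Rightarrow> bool" where
  "discrete_evolution m \<gamma> B D \<longleftrightarrow>
     D 0 = discretize \<gamma> B \<and> (\<forall>k. discrete_step m \<gamma> (D k) (D (Suc k)))"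

definition rescaled :: "real \<Rightarrow> (nat \<Rightarrow> bids) \<Rightarrow> real \<Rightarrow> bids" where
  "rescaled \<gamma> D t = D (nat \<lfloor>t / \<gamma>\<rfloor>)"

definition step_sizes :: "real set" where
  "step_sizes = {\<gamma>. \<gamma> \<in> {0<..<1} \<and> (\<exists>k::nat. \<gamma> = 1 / real k)}"

end

theory Submission
  imports Defs "HOL-Combinatorics.Permutations"
begin

text \<open>
  Every bidder's velocity divided by its own speed \<open>v\<^sub>i\<close> is a rate in \<open>[-1, 1]\<close>: 1 for bids
  below the price, -1 above, and the rates of all bidders add up to \<open>2np - n\<close>. This holds both for
  the discrete dynamics (rates \<open>\<plusminus>1\<close>, with bidders followed through the reorderings) and, almost
  everywhere in time, for the continuous one. Put \<open>e\<^sub>i = (b\<^sup>\<gamma>\<^sub>i - b\<^sub>i) / \<gamma>\<close> for each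
  bidder. If the errors in a set \<open>S\<close> of bidders exceed all others by a sufficient gap, then either
  on all of \<open>S\<close> the discrete rate is at most the continuous one, or off \<open>S\<close> it is at least the
  continuous one; as the totals agree, \<open>\<Sum>\<^sub>S e\<^sub>i / v\<^sub>i\<close> does not increase in the next
  step. The truncation to \<open>[0, 1]\<close> only helps if the errors in \<open>S\<close> are positive. Hence the bounds
  \<open>\<Sum>\<^sub>S e\<^sub>i / v\<^sub>i \<le> a \<mu>(S) - b \<mu>(S)\<^sup>2\<close>, \<open>\<mu>(S) = \<Sum>\<^sub>S 1 / v\<^sub>i\<close>, for all \<open>S\<close> are preserved, with
  \<open>a\<close> and \<open>b\<close> independent of \<open>\<gamma>\<close> and of time. The reflection \<open>b \<mapsto> 1 - b\<close> gives the bound from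
  below, and order statistics are nonexpansive, which carries the bound over to the \<open>i\<close>-th bids
  and to the price.
\<close>

section \<open>Growth of Lipschitz functions\<close>

text \<open>The derivative bound holds only almost everywhere. The exceptional null set is enclosed
  in an open set \<open>U\<close> of measure below \<open>\<epsilon>\<close>: near points of
  \<open>U\<close> the Lipschitz constant controls the growth, at a cost of \<open>K\<close> times
  the measure, and elsewhere the derivative does. Bisection glues these local estimates, and the
  total error is below any prescribed \<open>\<eta>\<close>.\<close>

lemma lipschitz_growth_le:
  fixes g :: "real \<Rightarrow> real"
  assumes lip: "L-lipschitz_on {a..b} g" and "a \<le> b"
    and der: "AE t in lborel. a < t \<and> t < b \<longrightarrow> (\<exists>d\<le>c. (g has_real_derivative d) (at t))"
  shows "g b - g a \<le> c * (b - a)"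
proof (rule field_le_epsilon)
  fix \<eta> :: real assume "\<eta> > 0"
  \<comment> \<open>\<open>M\<close> gathers the final errors per unit of \<open>\<epsilon>\<close>:
    \<open>b - a\<close> from the slope \<open>c + \<epsilon>\<close>, and at most
    \<open>L + \<bar>c\<bar> + 1\<close> from \<open>K * \<epsilon>\<close>.\<close>
  define M where "M = b - a + (L + \<bar>c\<bar> + 1) + 1"
  have L0: "L \<ge> 0" using lip by (rule lipschitz_on_nonneg)
  have M: "M > 0" using \<open>a \<le> b\<close> L0 by (auto simp: M_def)
  define \<epsilon> where "\<epsilon> = min 1 (\<eta> / M)"
  have \<epsilon>: "\<epsilon> > 0" "\<epsilon> \<le> 1" "\<epsilon> * M \<le> \<eta>"
    using \<open>\<eta> > 0\<close> M by (auto simp: \<epsilon>_def min_def field_simps)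
  define K where "K = L + \<bar>c\<bar> + \<epsilon>"
  obtain N0 where N0: "{t \<in> space lborel. \<not> (a < t \<and> t < b \<longrightarrow> (\<exists>d\<le>c. (g has_real_derivative d) (at t)))} \<subseteq> N0"
    "emeasure lborel N0 = 0" "N0 \<in> sets lborel"
    using der by (rule AE_E)
  \<comment> \<open>The end points join the null set since the derivative hypothesis covers only the
    open interval, while bisection needs an estimate at every point of
    \<open>{a..b}\<close>.\<close>
  define N where "N = insert a (insert b N0)"
  have "N0 \<in> null_sets lborel" using N0 by auto
  then have "N \<in> null_sets lborel"
    unfolding N_def by (metis finite.emptyI finite_imp_null_set_lborel finite_insert insert_is_Un null_sets.Un)
  then have "N \<in> null_sets lebesgue" by (rule null_sets_completionI)
  then have N: "N \<in> lmeasurable" "measure lebesgue N = 0"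
    by (auto simp: null_sets_def fmeasurable_def measure_def)
  then obtain U where U': "open U" "N \<subseteq> U" "U - N \<in> lmeasurable" "emeasure lebesgue (U - N) < ennreal \<epsilon>"
    using sets_lebesgue_outer_open[of N \<epsilon>] \<epsilon> by (auto dest: fmeasurableD)
  have Ueq: "U = N \<union> (U - N)" using U' by auto
  have U: "open U" "N \<subseteq> U" "U \<in> lmeasurable" "measure lebesgue U < \<epsilon>"
  proof -
    show "U \<in> lmeasurable" using Ueq N U' by (metis fmeasurable.Un)
    have "measure lebesgue U = measure lebesgue N + measure lebesgue (U - N)"
      using measure_Un2[OF N(1) U'(3)] Ueq by (simp add: Un_Diff)
    also have "\<dots> < \<epsilon>" using N U' \<epsilon> by (simp add: emeasure_eq_measure2 ennreal_less_iff)
    finally show "measure lebesgue U < \<epsilon>" .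
  qed (use U' in auto)
  define \<mu> where "\<mu> s t = measure lebesgue (U \<inter> {s<..t})" for s t
  have mble: "U \<inter> {s<..t} \<in> lmeasurable" for s t
    using U by (intro fmeasurable_Int_fmeasurable) auto
  define P where "P s t \<longleftrightarrow> (a \<le> s \<and> t \<le> b \<longrightarrow> g t - g s \<le> (c + \<epsilon>) * (t - s) + K * \<mu> s t)" for s t
  have "P a b"
  proof (rule Bolzano[OF \<open>a \<le> b\<close>])
    fix r s t assume *: "P r s" "P s t" "r \<le> s" "s \<le> t"
    have "U \<inter> {r<..t} = (U \<inter> {r<..s}) \<union> (U \<inter> {s<..t})" using * by auto
    then have "\<mu> r t = \<mu> r s + \<mu> s t"
      using measure_Un_AE[OF _ mble mble, of r s s t] by (auto simp: \<mu>_def)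
    then show "P r t" using * unfolding P_def by (auto simp: algebra_simps)
  next
    fix x assume x: "a \<le> x" "x \<le> b"
    show "\<exists>d>0. \<forall>s t. s \<le> x \<and> x \<le> t \<and> t - s < d \<longrightarrow> P s t"
    proof (cases "x \<in> U")
      case True
      then obtain d where d: "d > 0" "ball x d \<subseteq> U" using U by (meson openE)
      have "P s t" if st: "s \<le> x" "x \<le> t" "t - s < d" for s t
        unfolding P_def
      proof (intro impI)
        assume ab: "a \<le> s \<and> t \<le> b"
        have "{s<..t} \<subseteq> U" using d st by (auto simp: subset_iff dist_real_def)
        then have "\<mu> s t = t - s" using st by (simp add: \<mu>_def Int_absorb1)
        moreover have "g t - g s \<le> L * (t - s)"
          using lipschitz_onD[OF lip, of t s] st ab x by (auto simp: dist_real_def)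
        moreover have "(c + \<bar>c\<bar>) * (t - s) \<ge> 0" "\<epsilon> * (t - s) \<ge> 0" using st \<epsilon> by auto
        ultimately show "g t - g s \<le> (c + \<epsilon>) * (t - s) + K * \<mu> s t"
          unfolding \<open>\<mu> s t = t - s\<close> by (simp add: K_def algebra_simps)
      qed
      then show ?thesis using d by blast
    next
      case False
      then have "x \<notin> N" using U by auto
      then have "a < x" "x < b" using x by (auto simp: N_def)
      with N0(1) \<open>x \<notin> N\<close> obtain d where d: "d \<le> c" "(g has_real_derivative d) (at x)"
        by (auto simp: N_def)
      then have "((\<lambda>y. (g y - g x) / (y - x)) \<longlongrightarrow> d) (at x)"
        by (simp add: has_field_derivative_iff)
      then have "\<forall>\<^sub>F y in at x. (g y - g x) / (y - x) < c + \<epsilon>"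
        using d \<epsilon> by (intro order_tendstoD) auto
      then obtain \<delta> where \<delta>: "\<delta> > 0" "\<And>y. y \<noteq> x \<Longrightarrow> dist y x < \<delta> \<Longrightarrow> (g y - g x) / (y - x) < c + \<epsilon>"
        by (auto simp: eventually_at)
      have "P s t" if st: "s \<le> x" "x \<le> t" "t - s < \<delta>" for s t
      proof -
        have "g t - g x \<le> (c + \<epsilon>) * (t - x)"
        proof (cases "t = x")
          case False
          then show ?thesis using \<delta>(2)[of t] st by (auto simp: dist_real_def field_simps)
        qed auto
        moreover have "g x - g s \<le> (c + \<epsilon>) * (x - s)"
        proof (cases "s = x")
          case False
          then have "s < x" using st by auto
          then show ?thesis using \<delta>(2)[of s] st by (auto simp: dist_real_def field_simps)
        qed auto
        moreover have "K * \<mu> s t \<ge> 0" using L0 \<epsilon> by (auto simp: K_def \<mu>_def)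
        ultimately show ?thesis unfolding P_def by (auto simp: algebra_simps)
      qed
      then show ?thesis using \<delta> by blast
    qed
  qed
  then have "g b - g a \<le> (c + \<epsilon>) * (b - a) + K * \<mu> a b" by (simp add: P_def)
  moreover have "\<mu> a b \<le> \<epsilon>"
    using measure_mono_fmeasurable[of "U \<inter> {a<..b}" U lebesgue] U mble[of a b] by (auto simp: \<mu>_def)
  then have "K * \<mu> a b \<le> K * \<epsilon>" using \<epsilon> L0 by (intro mult_left_mono) (auto simp: K_def)
  moreover have "K * \<epsilon> \<le> (L + \<bar>c\<bar> + 1) * \<epsilon>" using \<epsilon> by (intro mult_right_mono) (auto simp: K_def)
  moreover have "\<epsilon> * M = \<epsilon> * (b - a) + (L + \<bar>c\<bar> + 1) * \<epsilon> + \<epsilon>" by (simp add: M_def algebra_simps)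
  moreover have "(c + \<epsilon>) * (b - a) = c * (b - a) + \<epsilon> * (b - a)" by (rule distrib_right)
  ultimately show "g b - g a \<le> c * (b - a) + \<eta>" using \<epsilon> by linarith
qed

section \<open>A concave barrier\<close>

text \<open>The case distinction compares the difference \<open>q - q'\<close> of the thresholds
  with the gap \<open>c\<close>. If it is at most \<open>c\<close>, every index in \<open>S\<close>
  has \<open>y\<close> above \<open>q\<close> or \<open>x\<close> below \<open>q'\<close>, so one of
  the rates is extreme and they compare in the right direction, whatever happens at ties. Otherwise
  the opposite comparison holds off \<open>S\<close>, and the equal totals carry it over to
  \<open>S\<close>.\<close>

lemma sum_le_by_threshold:
  fixes s s' :: "'i \<Rightarrow> real"
  assumes "finite I" "S \<subseteq> I" and total: "sum s I = sum s' I"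
    and bd: "\<And>i. i \<in> I \<Longrightarrow> \<bar>s i\<bar> \<le> 1" "\<And>i. i \<in> I \<Longrightarrow> \<bar>s' i\<bar> \<le> 1"
    and s: "\<And>i. i \<in> I \<Longrightarrow> y i < q \<Longrightarrow> s i = 1" "\<And>i. i \<in> I \<Longrightarrow> q < y i \<Longrightarrow> s i = -1"
    and s': "\<And>i. i \<in> I \<Longrightarrow> x i < q' \<Longrightarrow> s' i = 1" "\<And>i. i \<in> I \<Longrightarrow> q' < x i \<Longrightarrow> s' i = -1"
    and gap: "\<And>i. i \<in> S \<Longrightarrow> c < y i - x i" "\<And>i. i \<in> I - S \<Longrightarrow> y i - x i < (c::real)"
  shows "sum s S \<le> sum s' S"
proof (cases "q - q' \<le> c")
  case True
  show ?thesis
  proof (rule sum_mono)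
    fix i assume i: "i \<in> S"
    then have "i \<in> I" using assms by auto
    have "q < y i \<or> x i < q'" using gap(1)[OF i] True by linarith
    then show "s i \<le> s' i" using s(2)[OF \<open>i \<in> I\<close>] s'(1)[OF \<open>i \<in> I\<close>] bd[OF \<open>i \<in> I\<close>] by auto
  qed
next
  case False
  have "sum s' (I - S) \<le> sum s (I - S)"
  proof (rule sum_mono)
    fix i assume i: "i \<in> I - S"
    have "y i < q \<or> q' < x i" using gap(2)[OF i] False by linarith
    then show "s' i \<le> s i" using s(1)[of i] s'(2)[of i] bd[of i] i by auto
  qed
  then show ?thesis
    using total sum.subset_diff[OF \<open>S \<subseteq> I\<close> \<open>finite I\<close>, of s] sum.subset_diff[OF \<open>S \<subseteq> I\<close> \<open>finite I\<close>, of s']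
    by linarith
qed

text \<open>
  The barrier \<open>a \<mu> - b \<mu>\<^sup>2\<close> is strictly concave in the weight \<open>\<mu>\<close> of \<open>S\<close>. If it is nearly attained
  at \<open>S\<close>, comparing with the barrier for \<open>S\<close> with one element removed or added shows that the values
  of \<open>e\<close> on \<open>S\<close> and off \<open>S\<close> are separated by a large gap, which is where the hypothesis on the steps
  applies; otherwise there is room for one more step.
\<close>

lemma concave_barrier:
  fixes e :: "nat \<Rightarrow> 'i \<Rightarrow> real" and h :: "'i \<Rightarrow> real"
  assumes "finite I" and h: "\<And>i. i \<in> I \<Longrightarrow> 1 / V \<le> h i \<and> h i \<le> 1" and "V > 0" "c \<ge> 0" "H \<ge> 0" "K \<ge> 0"
    and init: "\<And>i. i \<in> I \<Longrightarrow> e 0 i \<le> 1"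
    and incr: "\<And>k i. i \<in> I \<Longrightarrow> e (Suc k) i - e k i \<le> c"
    and step: "\<And>k S z. \<lbrakk>S \<subseteq> I; K \<le> z; \<And>i. i \<in> S \<Longrightarrow> z + H \<le> e k i; \<And>i. i \<in> I - S \<Longrightarrow> e k i \<le> z - H\<rbrakk>
               \<Longrightarrow> (\<Sum>i\<in>S. h i * e (Suc k) i) \<le> (\<Sum>i\<in>S. h i * e k i)"
    and "i \<in> I"
  shows "e k i \<le> 2 * (V * (c * card I * V + H)) * card I + K + 1"
proof -
  \<comment> \<open>\<open>Q\<close> bounds the growth of any weighted sum in one step.
    \<open>b\<close> makes \<open>b * h i - Q / h i\<close> at least \<open>H\<close> for every
    weight, and \<open>a\<close> keeps the slope \<open>a - 2 * b * \<mu>\<close> of the barrier at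
    least \<open>K\<close> up to weight \<open>card I\<close>.\<close>
  define Q where "Q = c * card I"
  define b where "b = V * (Q * V + H)"
  define a where "a = 2 * b * card I + K + 1"
  define \<mu> where "\<mu> S = sum h S" for S
  define f where "f m = a * m - b * m\<^sup>2" for m
  have h0: "h i > 0" if "i \<in> I" for i
    using h[OF that] \<open>V > 0\<close> by (meson divide_pos_pos less_le_trans zero_less_one)
  have Q0: "Q \<ge> 0" using assms by (auto simp: Q_def)
  have b0: "b \<ge> 0" using assms Q0 by (auto simp: b_def)
  have \<mu>: "0 \<le> \<mu> S" "\<mu> S \<le> card I" if "S \<subseteq> I" for S
  proof -
    show "0 \<le> \<mu> S" using h0 that by (auto simp: \<mu>_def intro!: sum_nonneg intro: less_imp_le)
    have "\<mu> S \<le> \<mu> I" unfolding \<mu>_def using assms that h0 by (intro sum_mono2) (auto intro: less_imp_le)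
    also have "\<mu> I \<le> (\<Sum>i\<in>I. 1)" unfolding \<mu>_def using h by (intro sum_mono) auto
    finally show "\<mu> S \<le> card I" by simp
  qed
  have inv: "\<forall>S\<subseteq>I. (\<Sum>i\<in>S. h i * e k i) \<le> f (\<mu> S)" for k
  proof (induction k)
    case 0
    show ?case
    proof (intro allI impI)
      fix S assume S: "S \<subseteq> I"
      have "(\<Sum>i\<in>S. h i * e 0 i) \<le> \<mu> S" unfolding \<mu>_def
        using S h0 init by (intro sum_mono mult_left_le) (force intro: less_imp_le)+
      moreover have "b * (\<mu> S * \<mu> S) \<le> b * (card I * \<mu> S)" 
        using \<mu>[OF S] b0 by (intro mult_left_mono mult_right_mono) auto
      moreover have "0 \<le> b * (card I * \<mu> S)" "0 \<le> K * \<mu> S" using \<mu>[OF S] b0 assms by auto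
      ultimately show "(\<Sum>i\<in>S. h i * e 0 i) \<le> f (\<mu> S)"
        by (simp add: f_def a_def power2_eq_square algebra_simps)
    qed
  next
    case (Suc k)
    show ?case
    proof (intro allI impI)
      fix S assume S: "S \<subseteq> I"
      then have fin: "finite S" using assms finite_subset by auto
      show "(\<Sum>i\<in>S. h i * e (Suc k) i) \<le> f (\<mu> S)"
      proof (cases "(\<Sum>i\<in>S. h i * e k i) \<le> f (\<mu> S) - Q")
        case True
        have "(\<Sum>i\<in>S. h i * e (Suc k) i) \<le> (\<Sum>i\<in>S. h i * e k i + h i * c)"
        proof (rule sum_mono)
          fix i assume "i \<in> S"
          then have "e (Suc k) i \<le> e k i + c" "0 \<le> h i"
            using S incr[of i k] h0[of i] by (auto simp: subset_iff)
          then show "h i * e (Suc k) i \<le> h i * e k i + h i * c"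
            by (metis distrib_left mult_left_mono)
        qed
        also have "\<dots> = (\<Sum>i\<in>S. h i * e k i) + \<mu> S * c"
          by (simp add: sum.distrib \<mu>_def sum_distrib_right)
        also have "\<mu> S * c \<le> Q" using \<mu>[OF S] \<open>c \<ge> 0\<close> by (simp add: Q_def mult.commute mult_left_mono)
        finally show ?thesis using True by simp
      next
        case False
        \<comment> \<open>\<open>z\<close> is the derivative of \<open>f\<close> at
          \<open>\<mu> S\<close>. As \<open>f\<close> is quadratic, removing weight
          \<open>h i\<close> lowers it by exactly \<open>h i * (z + b * h i)\<close> and adding it
          raises it by \<open>h i * (z - b * h i)\<close>; hence the values on and off
          \<open>S\<close> fall on the two sides of \<open>z\<close>.\<close>
        define z where "z = a - 2 * b * \<mu> S"
        have bV: "b * h i - Q / h i \<ge> H" if "i \<in> I" for i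
        proof -
          have hV: "1 / h i \<le> V" "1 / V \<le> h i" using h[OF that] h0[OF that] \<open>V > 0\<close> by (auto simp: field_simps)
          have "Q / h i \<le> Q * V" using mult_left_mono[OF hV(1) Q0] by simp
          moreover have "b * h i \<ge> Q * V + H"
            using mult_left_mono[OF hV(2) b0] \<open>V > 0\<close> by (simp add: b_def)
          ultimately show ?thesis by simp
        qed
        have "z \<ge> K"
          using mult_left_mono[OF \<mu>(2)[OF S] b0] by (simp add: z_def a_def)
        moreover have "z + H \<le> e k i" if i: "i \<in> S" for i
        proof -
          have iI: "i \<in> I" using i S by auto
          have "(\<Sum>j\<in>S - {i}. h j * e k j) \<le> f (\<mu> (S - {i}))" using Suc.IH S by blast
          moreover have "\<mu> (S - {i}) = \<mu> S - h i"
            "(\<Sum>j\<in>S - {i}. h j * e k j) = (\<Sum>j\<in>S. h j * e k j) - h i * e k i"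
            using i fin by (auto simp: \<mu>_def sum_diff1)
          ultimately have "h i * e k i \<ge> f (\<mu> S) - f (\<mu> S - h i) - Q" using False by simp
          then have "h i * e k i \<ge> h i * (z + b * h i) - Q"
            by (simp add: f_def z_def power2_eq_square algebra_simps)
          then have "e k i \<ge> z + b * h i - Q / h i" using h0[OF iI] by (simp add: field_simps)
          then show ?thesis using bV[OF iI] by simp
        qed
        moreover have "e k i \<le> z - H" if i: "i \<in> I - S" for i
        proof -
          have iI: "i \<in> I" using i by auto
          have "(\<Sum>j\<in>insert i S. h j * e k j) \<le> f (\<mu> (insert i S))" using Suc.IH S iI by blast
          moreover have "\<mu> (insert i S) = \<mu> S + h i"
            "(\<Sum>j\<in>insert i S. h j * e k j) = (\<Sum>j\<in>S. h j * e k j) + h i * e k i"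
            using i fin by (auto simp: \<mu>_def)
          ultimately have "h i * e k i \<le> f (\<mu> S + h i) - f (\<mu> S) + Q" using False by simp
          then have "h i * e k i \<le> h i * (z - b * h i) + Q"
            by (simp add: f_def z_def power2_eq_square algebra_simps)
          then have "e k i \<le> z - b * h i + Q / h i" using h0[OF iI] by (simp add: field_simps)
          then show ?thesis using bV[OF iI] by simp
        qed
        ultimately have "(\<Sum>i\<in>S. h i * e (Suc k) i) \<le> (\<Sum>i\<in>S. h i * e k i)" by (intro step[OF S])
        also have "\<dots> \<le> f (\<mu> S)" using Suc.IH S by blast
        finally show ?thesis .
      qed
    qed
  qed
  \<comment> \<open>On singletons the barrier is a pointwise bound, at most \<open>a\<close> after
    division by the weight.\<close>
  have "h i * e k i \<le> h i * a - b * (h i)\<^sup>2"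
    using inv[of k, rule_format, of "{i}"] \<open>i \<in> I\<close> by (simp add: f_def \<mu>_def mult.commute)
  also have "\<dots> \<le> h i * a" using b0 by simp
  finally show ?thesis using h0[OF \<open>i \<in> I\<close>] by (simp add: a_def b_def Q_def)
qed

section \<open>Order statistics and the price\<close>

lemma card_nth_sort:
  "card {i. i < length xs \<and> P (sort xs ! i)} = card {i. i < length xs \<and> P (xs ! i)}"
proof -
  have "length (filter P (sort xs)) = length (filter P xs)" by (simp add: filter_sort)
  then show ?thesis by (simp add: length_filter_conv_card)
qed

text \<open>Counting the entries up to a level does not see the order of the list, so order
  statistics can be compared without a matching permutation.\<close>

lemma sort_nth_le_iff:
  fixes xs :: "'a::linorder list"
  assumes "k < length xs"
  shows "sort xs ! k \<le> z \<longleftrightarrow> k < card {i. i < length xs \<and> xs ! i \<le> z}"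
proof
  assume le: "sort xs ! k \<le> z"
  have "{..k} \<subseteq> {i. i < length xs \<and> sort xs ! i \<le> z}"
    using assms le by (auto intro: order_trans[OF sorted_nth_mono[OF sorted_sort]])
  then have "card {..k} \<le> card {i. i < length xs \<and> sort xs ! i \<le> z}" by (intro card_mono) auto
  then show "k < card {i. i < length xs \<and> xs ! i \<le> z}" using card_nth_sort[of xs "\<lambda>x. x \<le> z"] by simp
next
  assume "k < card {i. i < length xs \<and> xs ! i \<le> z}"
  then have k: "k < card {i. i < length xs \<and> sort xs ! i \<le> z}" using card_nth_sort[of xs "\<lambda>x. x \<le> z"] by simp
  show "sort xs ! k \<le> z"
  proof (rule ccontr)
    assume "\<not> sort xs ! k \<le> z"
    then have "{i. i < length xs \<and> sort xs ! i \<le> z} \<subseteq> {..<k}"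
      by (smt (verit, best) lessThan_iff linorder_not_le mem_Collect_eq order_trans sorted_nth_mono sorted_sort subsetI length_sort)
    then have "card {i. i < length xs \<and> sort xs ! i \<le> z} \<le> card {..<k}" by (intro card_mono) auto
    then show False using k by simp
  qed
qed

text \<open>Each index counted for \<open>ys\<close> at the level \<open>sort ys ! k\<close> is also
  counted for \<open>xs\<close> at that level raised by \<open>d\<close>.\<close>

lemma sort_nth_mono_add:
  fixes xs ys :: "real list"
  assumes "length ys = length xs" "k < length xs" "\<And>i. i < length xs \<Longrightarrow> xs ! i \<le> ys ! i + d"
  shows "sort xs ! k \<le> sort ys ! k + d"
proof -
  have "k < card {i. i < length ys \<and> ys ! i \<le> sort ys ! k}"
    using sort_nth_le_iff[of k ys] assms by auto
  also have "\<dots> \<le> card {i. i < length xs \<and> xs ! i \<le> sort ys ! k + d}"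
    using assms by (intro card_mono) fastforce+
  finally show ?thesis using sort_nth_le_iff[of k xs] assms by auto
qed

section \<open>Counting functions and the price as an order statistic\<close>

lemma cdf_eq_card: "cdf L x = real (card {i. i < length L \<and> fst (L ! i) \<le> x}) / real (length L)"
  unfolding cdf_def by (subst sum_of_bool_eq) (auto intro!: arg_cong[where f = card])

text \<open>With finitely many bids, the step function \<open>cdf L\<close> is constant just to the
  left of \<open>q\<close>, where it counts exactly the bids strictly below
  \<open>q\<close>.\<close>

lemma Lim_cdf_at_left:
  "Lim (at_left q) (cdf L) = real (card {i. i < length L \<and> fst (L ! i) < q}) / real (length L)"
proof -
  have "\<forall>\<^sub>F x in at_left q. fst (L ! i) \<le> x \<longleftrightarrow> fst (L ! i) < q" for i
  proof (cases "fst (L ! i) < q")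
    case True
    then have "\<forall>\<^sub>F x in at_left q. x \<in> {fst (L ! i)<..<q}" by (rule eventually_at_left_real)
    then show ?thesis by eventually_elim auto
  next
    case False
    have "\<forall>\<^sub>F x in at_left q. x < q" by (simp add: eventually_at_filter)
    then show ?thesis by eventually_elim (use False in auto)
  qed
  then have "\<forall>\<^sub>F x in at_left q. \<forall>i\<in>{..<length L}. fst (L ! i) \<le> x \<longleftrightarrow> fst (L ! i) < q"
    by (intro eventually_ball_finite) auto
  then have "\<forall>\<^sub>F x in at_left q. cdf L x = real (card {i. i < length L \<and> fst (L ! i) < q}) / real (length L)"
  proof eventually_elim
    case (elim x)
    then have "{i. i < length L \<and> fst (L ! i) \<le> x} = {i. i < length L \<and> fst (L ! i) < q}" by auto
    then show ?case by (simp add: cdf_eq_card)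
  qed
  then show ?thesis by (intro tendsto_Lim tendsto_eventually) auto
qed

text \<open>This is the quantile property in terms of counts. At \<open>m = 0\<close> the default
  value 0 of \<open>nth_bid\<close> fits because no bid is negative.\<close>

lemma card_bids_nth_bid:
  assumes "m \<le> length L" and nonneg: "\<And>i. i < length L \<Longrightarrow> 0 \<le> fst (L ! i)"
  shows "card {i. i < length L \<and> fst (L ! i) < nth_bid L m} \<le> m"
    and "m \<le> card {i. i < length L \<and> fst (L ! i) \<le> nth_bid L m}"
    and "0 < m \<Longrightarrow> card {i. i < length L \<and> fst (L ! i) < nth_bid L m} < m"
    and "0 \<le> nth_bid L m"
proof -
  show lt: "card {i. i < length L \<and> fst (L ! i) < nth_bid L m} < m" if "0 < m"
  proof -
    define ys where "ys = sort (map fst L)"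
    have "card {i. i < length L \<and> fst (L ! i) < nth_bid L m} = card {i. i < length L \<and> ys ! i < ys ! (m - 1)}"
      using card_nth_sort[of "map fst L" "\<lambda>x. x < nth_bid L m"] that
      by (simp add: nth_bid_def ys_def cong: conj_cong)
    also have "\<dots> \<le> card {..<m - 1}"
    proof (intro card_mono subsetI)
      fix i assume i: "i \<in> {i. i < length L \<and> ys ! i < ys ! (m - 1)}"
      then have "\<not> m - 1 \<le> i" using sorted_nth_mono[of ys "m - 1" i] by (auto simp: ys_def)
      then show "i \<in> {..<m - 1}" by simp
    qed auto
    finally show ?thesis using that by simp
  qed
  show "card {i. i < length L \<and> fst (L ! i) < nth_bid L m} \<le> m"
    using lt nonneg by (cases "m = 0") (force simp: nth_bid_def)+
  show "m \<le> card {i. i < length L \<and> fst (L ! i) \<le> nth_bid L m}"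
  proof (cases "m = 0")
    case False
    then have "m - 1 < length L" using assms by auto
    then have "m - 1 < card {i. i < length L \<and> fst (L ! i) \<le> nth_bid L m}"
      using sort_nth_le_iff[of "m - 1" "map fst L" "nth_bid L m"] False
      by (simp add: nth_bid_def cong: conj_cong)
    then show ?thesis by simp
  qed auto
  show "0 \<le> nth_bid L m"
  proof (cases "m = 0")
    case False
    then have "sort (map fst L) ! (m - 1) \<in> set (sort (map fst L))"
      using assms by (intro nth_mem) auto
    then have "nth_bid L m \<in> fst ` set L" using False by (simp add: nth_bid_def)
    then show ?thesis using nonneg by (metis imageE in_set_conv_nth)
  qed (simp add: nth_bid_def)
qed

lemma price_eq_nth_bid:
  assumes "L \<noteq> []" "m \<le> length L" and p: "p * real (length L) = real m"
    and nonneg: "\<And>i. i < length L \<Longrightarrow> 0 \<le> fst (L ! i)"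
  shows "price p L = nth_bid L m"
  unfolding price_def
proof (rule cInf_eq_minimum)
  have iff: "p \<le> cdf L x \<longleftrightarrow> m \<le> card {i. i < length L \<and> fst (L ! i) \<le> x}" for x
    using \<open>L \<noteq> []\<close> by (simp add: cdf_eq_card pos_le_divide_eq p)
  show "nth_bid L m \<in> {x. 0 \<le> x \<and> p \<le> cdf L x}"
    using card_bids_nth_bid[OF assms(2) nonneg] by (simp add: iff)
  fix x assume "x \<in> {x. 0 \<le> x \<and> p \<le> cdf L x}"
  then have x: "0 \<le> x" "m \<le> card {i. i < length L \<and> fst (L ! i) \<le> x}" by (auto simp: iff)
  show "nth_bid L m \<le> x"
  proof (rule ccontr)
    assume *: "\<not> nth_bid L m \<le> x"
    \<comment> \<open>For \<open>m = 0\<close> the default value 0 cannot exceed \<open>x\<close>,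
      so the strict count is available.\<close>
    then have "0 < m" using x by (auto simp: nth_bid_def split: if_splits)
    have "card {i. i < length L \<and> fst (L ! i) \<le> x} \<le> card {i. i < length L \<and> fst (L ! i) < nth_bid L m}"
      using * by (intro card_mono) auto
    then show False using x card_bids_nth_bid(3)[OF assms(2) nonneg \<open>0 < m\<close>] by auto
  qed
qed

text \<open>
  The formula for \<open>u\<close> is equivalent to this balance: dividing each velocity by the bidder's own
  speed gives a fractional assignment of win (+1) and loss (-1) with exactly \<open>m\<close> wins in total.
\<close>

lemma bid_velocity_balance:
  fixes L :: bids and \<nu>m \<nu>p m :: nat
  defines "s \<equiv> \<lambda>p i. bid_velocity \<nu>m \<nu>p p L (fst (L ! i)) (snd (L ! i)) / real (snd (L ! i))"
  assumes "0 < \<nu>m" "\<nu>m < \<nu>p" "L \<noteq> []" "m \<le> length L" and p: "p * real (length L) = real m"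
    and nonneg: "\<And>i. i < length L \<Longrightarrow> 0 \<le> fst (L ! i)"
    and vel: "\<And>i. i < length L \<Longrightarrow> snd (L ! i) \<in> {\<nu>m, \<nu>p}"
  shows "\<And>i. i < length L \<Longrightarrow> \<bar>s p i\<bar> \<le> 1"
    and "\<And>i. i < length L \<Longrightarrow> fst (L ! i) < price p L \<Longrightarrow> s p i = 1"
    and "\<And>i. i < length L \<Longrightarrow> price p L < fst (L ! i) \<Longrightarrow> s p i = -1"
    and "(\<Sum>i<length L. s p i) = 2 * real m - real (length L)"
proof -
  define n where "n = length L"
  define q where "q = price p L"
  define u where "u = price_velocity \<nu>m \<nu>p p L"
  define v where "v i = snd (L ! i)" for i
  define b where "b i = fst (L ! i)" for i
  have v: "v i = \<nu>m \<or> v i = \<nu>p" if "i < n" for i using vel that by (auto simp: v_def n_def)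
  have v0: "real (v i) > 0" if "i < n" for i using v[OF that] assms by auto
  have n0: "real n > 0" using \<open>L \<noteq> []\<close> by (simp add: n_def)
  have s: "s p i = (if b i < q then real (v i) else if b i > q then - real (v i)
             else if \<bar>u\<bar> \<le> real (v i) then u else sgn u * real (v i)) / real (v i)" for i
    by (simp add: s_def bid_velocity_def Let_def b_def v_def u_def q_def)
  show "\<bar>s p i\<bar> \<le> 1" if "i < length L" for i
    using v0[of i] that by (auto simp: s n_def abs_sgn_eq abs_mult)
  show "s p i = 1" if "i < length L" "fst (L ! i) < price p L" for i
    using v0[of i] that by (simp add: s n_def b_def q_def)
  show "s p i = -1" if "i < length L" "fst (L ! i) > price p L" for i
    using v0[of i] that by (simp add: s n_def b_def q_def)
  define W where "W = {i. i < n \<and> b i < q}"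
  define G where "G = {i. i < n \<and> b i = q}"
  define R where "R = {i. i < n \<and> b i > q}"
  define Gm where "Gm = {i. i < n \<and> b i = q \<and> v i = \<nu>m}"
  define Gp where "Gp = {i. i < n \<and> b i = q \<and> v i = \<nu>p}"
  have fin[simp]: "finite W" "finite G" "finite R" "finite Gm" "finite Gp"
    by (auto simp: W_def G_def R_def Gm_def Gp_def)
  have G: "G = Gm \<union> Gp" "Gm \<inter> Gp = {}" using v assms by (auto simp: G_def Gm_def Gp_def)
  have all: "{..<n} = W \<union> (G \<union> R)" "W \<inter> (G \<union> R) = {}" "G \<inter> R = {}"
    by (auto simp: W_def G_def R_def)
  have WG: "{i. i < n \<and> b i \<le> q} = W \<union> G" "W \<inter> G = {}" by (auto simp: W_def G_def)
  define g where "g = real (card G)"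
  define gm where "gm = real (card Gm)"
  define gp where "gp = real (card Gp)"
  have g: "g = gm + gp" using G by (simp add: g_def gm_def gp_def card_Un_disjoint)
  have n: "real n = real (card W) + g + real (card R)"
  proof -
    have "n = card {..<n}" by simp
    also have "\<dots> = card W + (card G + card R)"
      unfolding all(1) using all by (simp add: card_Un_disjoint)
    finally show ?thesis by (simp add: g_def)
  qed
  have "q = nth_bid L m" unfolding q_def using assms by (intro price_eq_nth_bid) auto
  then have cnt: "real (card W) \<le> real m" "real m \<le> real (card W) + g"
    using card_bids_nth_bid(1,2)[OF \<open>m \<le> length L\<close> nonneg] WG
    by (auto simp: W_def n_def b_def g_def card_Un_disjoint simp flip: of_nat_add)
  \<comment> \<open>\<open>k\<close> is the total rate left for the tied bids: \<open>W\<close>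
    contributes its cardinality, \<open>R\<close> minus its cardinality, and the sum must be
    \<open>2m - n\<close>.\<close>
  define k where "k = 2 * real m - 2 * real (card W) - g"
  have k: "\<bar>k\<bar> \<le> g" using cnt by (auto simp: k_def)
  have "p = real m / real n" using p n0 by (simp add: n_def field_simps)
  then have w: "winning_mass p L = (real m - real (card W)) / real n"
    by (simp add: winning_mass_def Lim_cdf_at_left W_def n_def b_def q_def diff_divide_distrib)
  have "cdf L q = (real (card W) + g) / real n"
    using WG by (simp add: cdf_eq_card n_def b_def g_def card_Un_disjoint)
  then have l: "losing_mass p L = (real (card W) + g - real m) / real n"
    using \<open>p = _\<close> by (simp add: losing_mass_def q_def diff_divide_distrib)
  have wl: "winning_mass p L - losing_mass p L = k / real n" "winning_mass p L + losing_mass p L = g / real n"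
    by (simp_all add: w l k_def diff_divide_distrib add_divide_distrib)
  have tied: "tied_mass p L \<nu>m = gm / real n" "tied_mass p L \<nu>p = gp / real n"
    unfolding tied_mass_def of_bool_conj[symmetric] by (subst sum_of_bool_eq;
      force simp: gm_def gp_def Gm_def Gp_def n_def b_def v_def q_def intro!: arg_cong[where f = card])+
  have sumG: "(\<Sum>i\<in>G. f (v i)) = gm * f \<nu>m + gp * f \<nu>p" for f :: "nat \<Rightarrow> real"
  proof -
    have "(\<Sum>i\<in>G. f (v i)) = (\<Sum>i\<in>Gm. f (v i)) + (\<Sum>i\<in>Gp. f (v i))"
      unfolding G(1) using G(2) by (intro sum.union_disjoint) auto
    also have "(\<Sum>i\<in>Gm. f (v i)) = (\<Sum>i\<in>Gm. f \<nu>m)" by (intro sum.cong) (auto simp: Gm_def)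
    also have "(\<Sum>i\<in>Gp. f (v i)) = (\<Sum>i\<in>Gp. f \<nu>p)" by (intro sum.cong) (auto simp: Gp_def)
    finally show ?thesis by (simp add: gm_def gp_def)
  qed
  \<comment> \<open>\<open>D\<close> adds the reciprocal speeds of the tied bids. If these all move
    with velocity \<open>u\<close>, their rates add up to \<open>u * D\<close>, so the balance
    forces \<open>u = k / D\<close>, the unsaturated case of the formula.\<close>
  define D where "D = gm / real \<nu>m + gp / real \<nu>p"
  have "(\<Sum>i<length L. 1 / real (snd (L ! i)) * of_bool (fst (L ! i) = price p L)) = (\<Sum>i\<in>G. 1 / real (v i))"
    by (intro sum.mono_neutral_cong_right) (auto simp: G_def n_def b_def v_def q_def)
  also have "\<dots> = D" by (simp add: sumG[of "\<lambda>x. 1 / real x"] D_def)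
  finally have mean: "mean_velocity p L = (g / real n) / (D / real n)"
    by (simp add: mean_velocity_def wl n_def)
  have sG: "(\<Sum>i\<in>G. s p i) = k"
  proof (cases "G = {}")
    \<comment> \<open>No bid need sit at the price if \<open>m = 0\<close>, where the price is the
      default 0; then \<open>\<bar>k\<bar> \<le> g\<close> gives \<open>k = 0\<close>.\<close>
    case True
    then show ?thesis using k by (simp add: g_def)
  next
    case False
    then have g0: "g > 0" by (simp add: g_def card_gt_0_iff)
    have pos: "real \<nu>m > 0" "real \<nu>p > 0" using assms by auto
    have ge0: "gm \<ge> 0" "gp \<ge> 0" by (auto simp: gm_def gp_def)
    have D0: "D > 0"
    proof (cases "gm = 0")
      case True then show ?thesis using g g0 pos by (simp add: D_def)
    next
      case False then show ?thesis using ge0 pos by (auto simp: D_def intro!: add_pos_nonneg)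
    qed
    have u: "u = (if \<bar>k / D\<bar> \<le> real \<nu>m then k / D else (k - sgn k * gm) / gp * real \<nu>p)"
    proof -
      have "k / real n / (g / real n) * (g / real n / (D / real n)) = k / D"
        using n0 g0 D0 by (simp add: field_simps)
      moreover have "(k / real n - sgn (k / real n) * (gm / real n)) / (gp / real n) = (k - sgn k * gm) / gp"
      proof -
        have "k / real n - sgn (k / real n) * (gm / real n) = (k - sgn k * gm) / real n"
          using n0 by (simp add: sgn_divide diff_divide_distrib)
        then show ?thesis using n0 by simp
      qed
      ultimately show ?thesis
        unfolding u_def price_velocity_def Let_def wl tied mean by (simp only:)
    qed
    have sv: "s p i = (if \<bar>u\<bar> \<le> real (v i) then u / real (v i) else sgn u)" if "i \<in> G" for i
      using that v0[of i] by (auto simp: s G_def)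
    have "(\<Sum>i\<in>G. s p i) = (\<Sum>i\<in>G. if \<bar>u\<bar> \<le> real (v i) then u / real (v i) else sgn u)"
      by (intro sum.cong sv) auto
    also have "\<dots> = gm * (if \<bar>u\<bar> \<le> real \<nu>m then u / real \<nu>m else sgn u) +
        gp * (if \<bar>u\<bar> \<le> real \<nu>p then u / real \<nu>p else sgn u)" by (rule sumG)
    also have "\<dots> = k"
    proof (cases "\<bar>k / D\<bar> \<le> real \<nu>m")
      case True
      then have "u = k / D" by (simp add: u)
      then have "\<bar>u\<bar> \<le> real \<nu>m" "\<bar>u\<bar> \<le> real \<nu>p" using True assms by auto
      moreover have "gm * (u / real \<nu>m) + gp * (u / real \<nu>p) = u * D" by (simp add: D_def distrib_left mult.commute)
      moreover have "u * D = k" using \<open>u = k / D\<close> D0 by simp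
      ultimately show ?thesis by simp
    next
      \<comment> \<open>The common velocity would exceed the slow speed. Slow tied bids saturate at
        the rate \<open>sgn k\<close> and the fast ones share the remaining
        \<open>k - sgn k * gm\<close>. The bounds \<open>lo\<close> and \<open>hi\<close> put
        \<open>\<bar>u\<bar>\<close> above \<open>\<nu>m\<close> and at most at
        \<open>\<nu>p\<close>, which selects exactly these branches.\<close>
      case False
      then have "\<bar>k\<bar> > real \<nu>m * D" using D0 by (simp add: field_simps)
      moreover have "real \<nu>m * D = gm + gp * (real \<nu>m / real \<nu>p)" using pos by (simp add: D_def distrib_left)
      ultimately have kk: "\<bar>k\<bar> > gm + gp * (real \<nu>m / real \<nu>p)" by simp
      have gp0: "gp > 0"
      proof (rule ccontr)
        assume "\<not> gp > 0"
        then have "gp = 0" using ge0 by simp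
        then show False using kk k g by simp
      qed
      have u': "u = sgn k * ((\<bar>k\<bar> - gm) / gp * real \<nu>p)"
        using False by (simp add: u sgn_if)
      have "0 \<le> gm + gp * (real \<nu>m / real \<nu>p)" using ge0 by simp
      then have k0: "k \<noteq> 0" using kk by linarith
      have "(\<bar>k\<bar> - gm) / gp > real \<nu>m / real \<nu>p" using kk gp0 by (simp add: field_simps)
      then have lo: "(\<bar>k\<bar> - gm) / gp * real \<nu>p > real \<nu>m" using pos by (simp add: pos_divide_less_eq)
      have "(\<bar>k\<bar> - gm) / gp \<le> 1" using k g gp0 by simp
      then have hi: "(\<bar>k\<bar> - gm) / gp * real \<nu>p \<le> real \<nu>p" using pos by (metis mult_right_mono mult_1 less_imp_le)
      have "\<bar>sgn k * c\<bar> = c \<and> sgn (sgn k * c) = sgn k" if "0 < c" for c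
        using that k0 by (simp add: abs_mult sgn_mult abs_sgn_eq)
      from this[OF order.strict_trans[OF pos(1) lo]]
      have au: "\<bar>u\<bar> = (\<bar>k\<bar> - gm) / gp * real \<nu>p" "sgn u = sgn k"
        unfolding u' by blast+
      have "gm * sgn u + gp * (u / real \<nu>p) = k"
        unfolding au(2) using gp0 pos by (simp add: u' sgn_if)
      then show ?thesis using au lo hi by auto
    qed
    finally show ?thesis .
  qed
  have "(\<Sum>i<length L. s p i) = (\<Sum>i\<in>W. s p i) + ((\<Sum>i\<in>G. s p i) + (\<Sum>i\<in>R. s p i))"
    unfolding n_def[symmetric] all(1) using all by (simp add: sum.union_disjoint)
  also have "(\<Sum>i\<in>W. s p i) = (\<Sum>i\<in>W. 1)" using v0 by (intro sum.cong) (auto simp: s W_def)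
  also have "(\<Sum>i\<in>R. s p i) = (\<Sum>i\<in>R. -1)" using v0 by (intro sum.cong) (auto simp: s R_def)
  finally show "(\<Sum>i<length L. s p i) = 2 * real m - real (length L)"
    using n by (simp add: sG k_def n_def)
qed

text \<open>Order statistics depend only on the multiset of bids, so both lists may be relabelled by
  bidder before nonexpansiveness is applied. At \<open>k = 0\<close> both values are the default
  0.\<close>

lemma nth_bid_diff_le:
  fixes L L' :: bids
  assumes "mset (map fst L) = mset (map y [0..<n])" "mset (map fst L') = mset (map x [0..<n])"
    and "\<And>i. i < n \<Longrightarrow> \<bar>y i - x i\<bar> \<le> d" and "k \<le> n" "0 \<le> d"
  shows "\<bar>nth_bid L k - nth_bid L' k\<bar> \<le> d"
proof (cases "k = 0")
  case False
  have "sort (map fst L) = sort (map y [0..<n])" "sort (map fst L') = sort (map x [0..<n])"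
    using assms(1,2) by (metis mset_sort properties_for_sort sorted_sort)+
  then show ?thesis
    using False sort_nth_mono_add[of "map x [0..<n]" "map y [0..<n]" "k - 1" d]
      sort_nth_mono_add[of "map y [0..<n]" "map x [0..<n]" "k - 1" d] assms(3,4)
    by (force simp: nth_bid_def abs_le_iff)
qed (use assms in \<open>simp add: nth_bid_def\<close>)

section \<open>Comparison of the evolutions\<close>

lemma nth_move_bids:
  assumes "i < length L" "m \<le> length L"
  shows "move_bids m \<gamma> L ! i =
    (clip (fst (L ! i) + \<gamma> * (real (snd (L ! i)) * (if i < m then 1 else -1))), snd (L ! i))"
  using assms by (auto simp: move_bids_def nth_append case_prod_beta)

text \<open>Undoing the reorderings gives each bidder a fixed index: \<open>y k i\<close> is the bid
  and \<open>s k i\<close> the win (+1) or loss (-1) of the bidder who starts at position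
  \<open>i\<close>. Each step is a permutation however ties are broken; a bidder tied with the price
  may win or lose, so no sign is claimed there.\<close>

lemma discrete_evolution_labelling:
  assumes D: "discrete_evolution m \<gamma> B D" and m: "m \<le> length B" and "\<gamma> > 0"
    and B: "sorted (map fst B)" "\<And>i. i < length B \<Longrightarrow> fst (B ! i) \<in> {0..1}"
  obtains y :: "nat \<Rightarrow> nat \<Rightarrow> real" and s :: "nat \<Rightarrow> nat \<Rightarrow> real" where
    "\<And>i. i < length B \<Longrightarrow> y 0 i = \<gamma> * of_int \<lfloor>fst (B ! i) / \<gamma>\<rfloor>"
    "\<And>k i. i < length B \<Longrightarrow> y (Suc k) i = clip (y k i + \<gamma> * (real (snd (B ! i)) * s k i))"
    "\<And>k i. i < length B \<Longrightarrow> y k i \<in> {0..1}"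
    "\<And>k i. i < length B \<Longrightarrow> \<bar>s k i\<bar> = 1"
    "\<And>k. (\<Sum>i<length B. s k i) = 2 * real m - real (length B)"
    "\<And>k i. i < length B \<Longrightarrow> y k i < nth_bid (D k) m \<Longrightarrow> s k i = 1"
    "\<And>k i. i < length B \<Longrightarrow> nth_bid (D k) m < y k i \<Longrightarrow> s k i = -1"
    "\<And>k. mset (map fst (D k)) = mset (map (y k) [0..<length B])"
proof -
  define n where "n = length B"
  have D0: "D 0 = discretize \<gamma> B" and st: "\<And>k. discrete_step m \<gamma> (D k) (D (Suc k))"
    using D by (auto simp: discrete_evolution_def)
  have len: "length (D k) = n" for k
  proof (induction k)
    case 0 show ?case by (simp add: D0 discretize_def n_def)
  next
    case (Suc k)
    have "length (D (Suc k)) = length (move_bids m \<gamma> (D k))"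
      using st[of k] by (intro mset_eq_length) (simp add: discrete_step_def)
    then show ?case using Suc m by (simp add: move_bids_def n_def)
  qed
  have sorted: "sorted (map fst (D k))" for k
  proof (cases k)
    case 0
    have "mono (\<lambda>b. \<gamma> * of_int \<lfloor>b / \<gamma>\<rfloor>)"
      using \<open>\<gamma> > 0\<close> by (intro monoI mult_left_mono) (auto intro!: floor_mono divide_right_mono)
    then have "sorted (map (\<lambda>b. \<gamma> * of_int \<lfloor>b / \<gamma>\<rfloor>) (map fst B))"
      using B(1) by (auto simp: sorted_iff_nth_mono mono_def)
    then show ?thesis by (simp add: 0 D0 discretize_def o_def case_prod_beta)
  next
    case (Suc j)
    then show ?thesis using st[of j] by (simp add: discrete_step_def)
  qed
  have "\<exists>p. p permutes {..<n} \<and> permute_list p (move_bids m \<gamma> (D k)) = D (Suc k)" for k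
    using mset_eq_permutation[of "D (Suc k)" "move_bids m \<gamma> (D k)"] st[of k] len m
    by (metis discrete_step_def mset_eq_length)
  then obtain p where p: "\<And>k. p k permutes {..<n}"
    "\<And>k. permute_list (p k) (move_bids m \<gamma> (D k)) = D (Suc k)" by metis
  \<comment> \<open>\<open>\<sigma> k i\<close> is the position of bidder \<open>i\<close> after
    \<open>k\<close> steps. The inverse appears because \<open>permute_list\<close> puts the entry
    at position \<open>p k j\<close> into position \<open>j\<close>.\<close>
  define \<sigma> where "\<sigma> = rec_nat id (\<lambda>k \<tau>. inv (p k) \<circ> \<tau>)"
  have \<sigma>_Suc: "\<sigma> (Suc k) = inv (p k) \<circ> \<sigma> k" for k by (simp add: \<sigma>_def)
  have \<sigma>: "\<sigma> k permutes {..<n}" for k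
  proof (induction k)
    case 0 show ?case using permutes_id by (simp add: \<sigma>_def id_def)
  next
    case (Suc k)
    then show ?case unfolding \<sigma>_Suc by (intro permutes_compose permutes_inv p)
  qed
  have \<sigma>_less: "\<sigma> k i < n" if "i < n" for k i
    using permutes_in_image[OF \<sigma>, of k i] that by simp
  define s where "s k i = (if \<sigma> k i < m then 1 else - 1 :: real)" for k i
  define y where "y k i = fst (D k ! \<sigma> k i)" for k i
  have D_Suc: "D (Suc k) ! \<sigma> (Suc k) i =
      (clip (y k i + \<gamma> * (real (snd (D k ! \<sigma> k i)) * s k i)), snd (D k ! \<sigma> k i))" if "i < n" for k i
  proof -
    have lm: "length (move_bids m \<gamma> (D k)) = n" using len m by (simp add: move_bids_def n_def)
    have "D (Suc k) ! \<sigma> (Suc k) i = permute_list (p k) (move_bids m \<gamma> (D k)) ! \<sigma> (Suc k) i"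
      by (simp add: p(2))
    also have "\<dots> = move_bids m \<gamma> (D k) ! p k (\<sigma> (Suc k) i)"
      using p(1) lm \<sigma>_less[OF that] by (intro permute_list_nth) auto
    also have "p k (\<sigma> (Suc k) i) = \<sigma> k i"
      using permutes_inverses(1)[OF p(1)] by (simp add: \<sigma>_Suc)
    finally show ?thesis
      using \<sigma>_less[OF that] m by (simp add: nth_move_bids len n_def y_def s_def)
  qed
  have snd: "snd (D k ! \<sigma> k i) = snd (B ! i)" if "i < n" for k i
  proof (induction k)
    case 0 show ?case using that by (simp add: D0 \<sigma>_def discretize_def n_def case_prod_beta)
  qed (use D_Suc[OF that] in simp)
  have y0: "y 0 i = \<gamma> * of_int \<lfloor>fst (B ! i) / \<gamma>\<rfloor>" if "i < n" for i
    using that by (simp add: y_def D0 \<sigma>_def discretize_def n_def case_prod_beta)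
  have y_Suc: "y (Suc k) i = clip (y k i + \<gamma> * (real (snd (B ! i)) * s k i))" if "i < n" for k i
    using D_Suc[OF that, of k] snd[OF that, of k] unfolding y_def[of "Suc k"] by simp
  have y01: "y k i \<in> {0..1}" if "i < n" for k i
  proof (cases k)
    case 0
    have "\<gamma> * of_int \<lfloor>fst (B ! i) / \<gamma>\<rfloor> \<le> \<gamma> * (fst (B ! i) / \<gamma>)"
      using \<open>\<gamma> > 0\<close> by (intro mult_left_mono of_int_floor_le) auto
    then have "y 0 i \<le> fst (B ! i)" using \<open>\<gamma> > 0\<close> y0[OF that] by simp
    then show ?thesis using 0 y0[OF that] B(2)[of i] that \<open>\<gamma> > 0\<close> by (auto simp: n_def)
  next
    case (Suc j)
    then show ?thesis using y_Suc[OF that] by (simp add: clip_def)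
  qed
  have q: "nth_bid (D k) m = fst (D k ! (m - 1))" if "0 < m" for k
  proof -
    have "sort (map fst (D k)) = map fst (D k)" using sorted by (rule sorted_sort_id)
    then show ?thesis using that m len[of k] by (simp add: nth_bid_def n_def)
  qed
  have mono: "fst (D k ! i) \<le> fst (D k ! j)" if "i \<le> j" "j < n" for k i j
    using sorted_nth_mono[OF sorted, of i j k] that len[of k] by simp
  show ?thesis
  proof
    show "s k i = 1" if "i < length B" "y k i < nth_bid (D k) m" for k i
    proof (cases "m = 0")
      \<comment> \<open>The default price 0 has no bid below it, so the premise is
        contradictory.\<close>
      case True
      then show ?thesis using that y01[of i k] by (auto simp: nth_bid_def n_def)
    next
      case False
      then have "\<not> m - 1 \<le> \<sigma> k i"
        using mono[of "m - 1" "\<sigma> k i" k] \<sigma>_less[of i k] that q[of k] by (auto simp: y_def n_def)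
      then show ?thesis by (simp add: s_def)
    qed
    show "s k i = -1" if "i < length B" "nth_bid (D k) m < y k i" for k i
    proof (cases "m = 0")
      case False
      then have "m - 1 < n" using m by (simp add: n_def)
      then have "\<not> \<sigma> k i \<le> m - 1"
        using mono[of "\<sigma> k i" "m - 1" k] False that q[of k] by (auto simp: y_def n_def)
      then show ?thesis by (simp add: s_def)
    qed (simp add: s_def)
    show "mset (map fst (D k)) = mset (map (y k) [0..<length B])" for k
    proof -
      have "map (y k) [0..<length B] = permute_list (\<sigma> k) (map fst (D k))"
        using len[of k] \<sigma>_less by (auto simp: permute_list_def y_def n_def)
      then show ?thesis using \<sigma>[of k] len[of k] by simp
    qed
    show "(\<Sum>i<length B. s k i) = 2 * real m - real (length B)" for k
    proof -
      have "(\<Sum>i<n. s k i) = (\<Sum>i<n. if i < m then 1 else - 1)"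
        using sum.permute[OF \<sigma>[of k], of "\<lambda>i. if i < m then 1 else - 1 :: real"] by (simp add: s_def o_def)
      also have "\<dots> = (\<Sum>i\<in>{..<m} \<union> {m..<n}. if i < m then 1 else - 1)"
        using m by (intro sum.cong) (auto simp: n_def)
      also have "\<dots> = real m - real (n - m)" by (subst sum.union_disjoint) auto
      finally show ?thesis using m by (simp add: n_def)
    qed
  qed (use y0 y_Suc y01 in \<open>auto simp: n_def s_def\<close>)
qed

text \<open>Only the weighted sum of the derivatives is bounded, not each of them, so the growth
  bound is applied to the negated sum as a single Lipschitz function.\<close>

lemma sum_lipschitz_growth_ge:
  fixes x :: "real \<Rightarrow> 'i \<Rightarrow> real" and h :: "'i \<Rightarrow> real"
  assumes "a \<le> b" and lip: "\<And>i. i \<in> S \<Longrightarrow> L-lipschitz_on {a..b} (\<lambda>t. x t i)"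
    and h: "\<And>i. i \<in> S \<Longrightarrow> \<bar>h i\<bar> \<le> 1" and "0 \<le> L"
    and der: "AE t in lborel. a < t \<and> t < b \<longrightarrow>
      (\<exists>g. (\<forall>i\<in>S. ((\<lambda>t. x t i) has_real_derivative g i) (at t)) \<and> c \<le> (\<Sum>i\<in>S. h i * g i))"
  shows "c * (b - a) \<le> (\<Sum>i\<in>S. h i * (x b i - x a i))"
proof -
  define f where "f t = - (\<Sum>i\<in>S. h i * x t i)" for t
  have "(real (card S) * L)-lipschitz_on {a..b} f"
  proof (rule lipschitz_onI)
    fix s t assume st: "s \<in> {a..b}" "t \<in> {a..b}"
    have "dist (f s) (f t) = \<bar>\<Sum>i\<in>S. h i * (x s i - x t i)\<bar>"
      by (simp add: f_def dist_real_def right_diff_distrib sum_subtractf abs_minus_commute)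
    also have "\<dots> \<le> (\<Sum>i\<in>S. \<bar>h i * (x s i - x t i)\<bar>)" by (rule sum_abs)
    also have "\<dots> \<le> (\<Sum>i\<in>S. L * dist s t)"
    proof (rule sum_mono)
      fix i assume i: "i \<in> S"
      have "\<bar>h i\<bar> * \<bar>x s i - x t i\<bar> \<le> \<bar>x s i - x t i\<bar>" using h[OF i] by (intro mult_left_le_one_le) auto
      also have "\<dots> \<le> L * dist s t" using lipschitz_onD[OF lip[OF i] st] by (simp add: dist_real_def)
      finally show "\<bar>h i * (x s i - x t i)\<bar> \<le> L * dist s t" by (simp add: abs_mult)
    qed
    finally show "dist (f s) (f t) \<le> real (card S) * L * dist s t" by simp
  qed (use \<open>0 \<le> L\<close> in simp)
  moreover have "AE t in lborel. a < t \<and> t < b \<longrightarrow> (\<exists>d\<le>-c. (f has_real_derivative d) (at t))"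
    using der
  proof eventually_elim
    case (elim t)
    show ?case
    proof
      assume "a < t \<and> t < b"
      then obtain g where g: "\<forall>i\<in>S. ((\<lambda>t. x t i) has_real_derivative g i) (at t)" "c \<le> (\<Sum>i\<in>S. h i * g i)"
        using elim by auto
      have "(f has_real_derivative - (\<Sum>i\<in>S. h i * g i)) (at t)"
        unfolding f_def using g by (intro DERIV_minus DERIV_sum DERIV_cmult) auto
      then show "\<exists>d\<le>-c. (f has_real_derivative d) (at t)"
        using g by (intro exI[of _ "- (\<Sum>i\<in>S. h i * g i)"]) auto
    qed
  qed
  ultimately have "f b - f a \<le> - c * (b - a)" using \<open>a \<le> b\<close> by (intro lipschitz_growth_le)
  then show ?thesis by (simp add: f_def right_diff_distrib sum_subtractf)
qed

text \<open>Common form of both dynamics: \<open>s\<close> holds the velocities divided by the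
  bidders' own speeds, before truncation to the interval. Bids at the threshold \<open>q\<close> may
  have any rate in \<open>[-1, 1]\<close>, which covers tie-breaking as well as joint motion with
  the price.\<close>

definition rates :: "'i set \<Rightarrow> real \<Rightarrow> ('i \<Rightarrow> real) \<Rightarrow> real \<Rightarrow> ('i \<Rightarrow> real) \<Rightarrow> bool" where
  "rates I c x q s \<longleftrightarrow> sum s I = c \<and>
     (\<forall>i\<in>I. \<bar>s i\<bar> \<le> 1 \<and> (x i < q \<longrightarrow> s i = 1) \<and> (q < x i \<longrightarrow> s i = -1))"

text \<open>The reflection of the unit interval exchanges winners and losers. Together with the
  reflection of \<open>confined\<close> and \<open>clip\<close> it turns an upper bound on the error
  into a lower one.\<close>

lemma rates_reflect: "rates I c x q s \<Longrightarrow> rates I (- c) (\<lambda>i. 1 - x i) (1 - q) (\<lambda>i. - s i)"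
  by (auto simp: rates_def sum_negf)

lemma confined_reflect: "confined (1 - x) (- g) = - confined x g"
  by (auto simp: confined_def)

lemma clip_reflect: "1 - clip z = clip (1 - z)"
  by (auto simp: clip_def)

text \<open>The barrier is applied to the errors in units of \<open>\<gamma>\<close>, with weights
  \<open>1 / v i\<close> turning velocities into rates. If the errors on \<open>S\<close> are
  separated from the others, the rates compare at almost every time of the step; integrating this
  shows that the weighted error over \<open>S\<close> does not grow.\<close>

lemma discrete_minus_continuous_le:
  fixes x :: "real \<Rightarrow> 'i \<Rightarrow> real" and y s :: "nat \<Rightarrow> 'i \<Rightarrow> real" and v :: "'i \<Rightarrow> real"
  assumes "finite I" "\<gamma> > 0" and v: "\<And>i. i \<in> I \<Longrightarrow> 1 \<le> v i \<and> v i \<le> V" and "0 < V" "0 \<le> L"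
    and init: "\<And>i. i \<in> I \<Longrightarrow> y 0 i - x 0 i \<le> \<gamma>"
    and y: "\<And>k i. i \<in> I \<Longrightarrow> y k i \<in> {0..1}"
      "\<And>k i. i \<in> I \<Longrightarrow> y (Suc k) i = clip (y k i + \<gamma> * (v i * s k i))"
      "\<And>k. \<exists>q. rates I c (y k) q (s k)"
    and x: "\<And>t i. i \<in> I \<Longrightarrow> 0 \<le> t \<Longrightarrow> x t i \<in> {0..1}"
      "\<And>i. i \<in> I \<Longrightarrow> L-lipschitz_on {0..} (\<lambda>t. x t i)"
      "AE t in lborel. 0 < t \<longrightarrow> (\<exists>q r. rates I c (x t) q r \<and>
        (\<forall>i\<in>I. ((\<lambda>t. x t i) has_real_derivative confined (x t i) (v i * r i)) (at t)))"
    and "i \<in> I"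
  shows "y k i - x (real k * \<gamma>) i \<le> \<gamma> * (2 * (V * ((V + L) * card I * V + (L + 1))) * card I + V + 1)"
proof -
  define e where "e k i = (y k i - x (real k * \<gamma>) i) / \<gamma>" for k i
  have ye: "y k i = x (real k * \<gamma>) i + \<gamma> * e k i" for k i using \<open>\<gamma> > 0\<close> by (simp add: e_def)
  have near: "\<bar>x t i - x (real k * \<gamma>) i\<bar> \<le> L * \<gamma>"
    if "i \<in> I" "real k * \<gamma> \<le> t" "t \<le> real (Suc k) * \<gamma>" for i t k
  proof -
    have "0 \<le> real k * \<gamma>" using \<open>\<gamma> > 0\<close> by simp
    then have "\<bar>x t i - x (real k * \<gamma>) i\<bar> \<le> L * \<bar>t - real k * \<gamma>\<bar>"
      using lipschitz_onD[OF x(2)[OF that(1)], of t "real k * \<gamma>"] that by (simp add: dist_real_def)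
    also have "\<dots> \<le> L * \<gamma>"
      using that \<open>0 \<le> L\<close> by (intro mult_left_mono) (auto simp: algebra_simps)
    finally show ?thesis .
  qed
  have vs: "\<bar>v i * s k i\<bar> \<le> V" if "i \<in> I" for k i
  proof -
    have "\<bar>v i * s k i\<bar> \<le> V * 1" unfolding abs_mult
      using y(3)[of k] v[OF that] that by (intro mult_mono') (auto simp: rates_def)
    then show ?thesis by simp
  qed
  have le: "real k * \<gamma> \<le> real (Suc k) * \<gamma>" for k using \<open>\<gamma> > 0\<close> by simp
  have "e k i \<le> 2 * (V * ((V + L) * card I * V + (L + 1))) * card I + V + 1"
  \<comment> \<open>The barrier is used with increment \<open>V + L\<close>,
    \<open>H = L + 1\<close> and \<open>K = V\<close>. In \<open>H\<close>, the term
    \<open>L\<close> absorbs the motion of the continuous bids during a step and 1 keeps the gap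
    strict; \<open>K = V\<close> keeps the discrete bids of \<open>S\<close> further than one step
    from 0.\<close>
  proof (rule concave_barrier[where h = "\<lambda>i. 1 / v i" and I = I])
    show "1 / V \<le> 1 / v i \<and> 1 / v i \<le> 1" if "i \<in> I" for i
      using v[OF that] by (auto simp: frac_le)
    show "e 0 i \<le> 1" if "i \<in> I" for i using init[OF that] \<open>\<gamma> > 0\<close> by (simp add: e_def)
    show "e (Suc k) i - e k i \<le> V + L" if i: "i \<in> I" for k i
    proof -
      have "v i * s k i \<le> V" using vs[OF i, of k] by simp
      then have "\<gamma> * (v i * s k i) \<le> \<gamma> * V" using \<open>\<gamma> > 0\<close> by (intro mult_left_mono) auto
      then have "y (Suc k) i - y k i \<le> \<gamma> * V"
        using y(1)[OF i, of k] mult_pos_pos[OF \<open>\<gamma> > 0\<close> \<open>0 < V\<close>]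
        unfolding y(2)[OF i] clip_def atLeastAtMost_iff by linarith
      moreover have "x (real k * \<gamma>) i - x (real (Suc k) * \<gamma>) i \<le> \<gamma> * L"
        using near[OF i le order_refl, of k] by (simp add: mult.commute)
      ultimately have "\<gamma> * (e (Suc k) i - e k i) \<le> \<gamma> * (V + L)"
        by (simp add: ye algebra_simps)
      then show ?thesis using \<open>\<gamma> > 0\<close> by simp
    qed
    show "(\<Sum>i\<in>S. 1 / v i * e (Suc k) i) \<le> (\<Sum>i\<in>S. 1 / v i * e k i)"
      if S: "S \<subseteq> I" and z: "V \<le> z" and hi: "\<And>i. i \<in> S \<Longrightarrow> z + (L + 1) \<le> e k i"
        and lo: "\<And>i. i \<in> I - S \<Longrightarrow> e k i \<le> z - (L + 1)" for k S z
    proof -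
      have SI: "i \<in> I" if "i \<in> S" for i using S that by auto
      \<comment> \<open>The discrete bids are frozen over the step while \<open>t\<close> varies:
        the gap around \<open>\<gamma> * z\<close> persists for all times in it.\<close>
      have hi': "\<gamma> * z < y k i - x t i"
        if "i \<in> S" "real k * \<gamma> \<le> t" "t \<le> real (Suc k) * \<gamma>" for i t
      proof -
        have "\<gamma> * (z + (L + 1)) \<le> \<gamma> * e k i" using hi[OF that(1)] \<open>\<gamma> > 0\<close> by simp
        then show ?thesis using near[OF SI[OF that(1)] that(2,3)] \<open>\<gamma> > 0\<close> ye[of k i]
          by (simp add: algebra_simps abs_le_iff)
      qed
      have lo': "y k i - x t i < \<gamma> * z"
        if "i \<in> I - S" "real k * \<gamma> \<le> t" "t \<le> real (Suc k) * \<gamma>" for i t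
      proof -
        have "\<gamma> * e k i \<le> \<gamma> * (z - (L + 1))" using lo[OF that(1)] \<open>\<gamma> > 0\<close> by simp
        then show ?thesis using near[of i k t] that \<open>\<gamma> > 0\<close> ye[of k i]
          by (simp add: algebra_simps abs_le_iff)
      qed
      obtain q where q: "rates I c (y k) q (s k)" using y(3) by blast
      have "sum (s k) S * (real (Suc k) * \<gamma> - real k * \<gamma>)
        \<le> (\<Sum>i\<in>S. 1 / v i * (x (real (Suc k) * \<gamma>) i - x (real k * \<gamma>) i))"
      proof (rule sum_lipschitz_growth_ge[OF le _ _ \<open>0 \<le> L\<close>])
        show "L-lipschitz_on {real k * \<gamma>..real (Suc k) * \<gamma>} (\<lambda>t. x t i)" if "i \<in> S" for i
          using x(2)[OF SI[OF that]] by (rule lipschitz_on_subset) (use \<open>\<gamma> > 0\<close> in auto)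
        show "\<bar>1 / v i\<bar> \<le> 1" if "i \<in> S" for i using v[OF SI[OF that]] by auto
        show "AE t in lborel. real k * \<gamma> < t \<and> t < real (Suc k) * \<gamma> \<longrightarrow>
          (\<exists>g. (\<forall>i\<in>S. ((\<lambda>t. x t i) has_real_derivative g i) (at t)) \<and> sum (s k) S \<le> (\<Sum>i\<in>S. 1 / v i * g i))"
          using x(3)
        proof eventually_elim
          case (elim t)
          show ?case
          proof
            assume t: "real k * \<gamma> < t \<and> t < real (Suc k) * \<gamma>"
            have "0 \<le> real k * \<gamma>" using \<open>\<gamma> > 0\<close> by simp
            then have "0 < t" using t by linarith
            then obtain q' r where r: "rates I c (x t) q' r"
              "\<forall>i\<in>I. ((\<lambda>t. x t i) has_real_derivative confined (x t i) (v i * r i)) (at t)"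
              using elim by blast
            have "sum (s k) S \<le> sum r S"
              using q r(1) t S \<open>finite I\<close> hi'[of _ t] lo'[of _ t] unfolding rates_def
              by (intro sum_le_by_threshold[of I S "s k" r "y k" q "x t" q' "\<gamma> * z"]) auto
            also have "\<dots> \<le> (\<Sum>i\<in>S. 1 / v i * confined (x t i) (v i * r i))"
            proof (rule sum_mono)
              fix i assume i: "i \<in> S"
              \<comment> \<open>A positive error keeps the continuous bid below 1, so confinement
                can only act at 0, where it increases the velocity.\<close>
              have "0 < \<gamma> * z" using \<open>\<gamma> > 0\<close> z \<open>0 < V\<close> by simp
              then have "x t i < 1" using hi'[OF i, of t] t y(1)[OF SI[OF i], of k] by auto
              then have "v i * r i \<le> confined (x t i) (v i * r i)" by (auto simp: confined_def)
              then show "r i \<le> 1 / v i * confined (x t i) (v i * r i)"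
                using v[OF SI[OF i]] by (simp add: field_simps)
            qed
            finally show "\<exists>g. (\<forall>i\<in>S. ((\<lambda>t. x t i) has_real_derivative g i) (at t)) \<and>
              sum (s k) S \<le> (\<Sum>i\<in>S. 1 / v i * g i)"
              using r(2) SI by (intro exI[of _ "\<lambda>i. confined (x t i) (v i * r i)"]) auto
          qed
        qed
      qed
      moreover have "(\<Sum>i\<in>S. 1 / v i * (y (Suc k) i - y k i)) \<le> (\<Sum>i\<in>S. \<gamma> * s k i)"
      proof (rule sum_mono)
        fix i assume i: "i \<in> S"
        \<comment> \<open>The discrete bid exceeds \<open>\<gamma> * V\<close>, so one step cannot
          reach 0; truncation can only act at 1, where it lowers the bid.\<close>
        have "v i * s k i \<ge> - V" using vs[OF SI[OF i], of k] by simp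
        then have "\<gamma> * (v i * s k i) \<ge> - (\<gamma> * V)" using \<open>\<gamma> > 0\<close> mult_left_mono by fastforce
        moreover have "\<gamma> * V \<le> \<gamma> * z" using z \<open>\<gamma> > 0\<close> by simp
        moreover have "\<gamma> * z < y k i"
          using hi'[OF i order_refl le] x(1)[OF SI[OF i], of "real k * \<gamma>"] \<open>\<gamma> > 0\<close> by auto
        ultimately have "y (Suc k) i - y k i \<le> \<gamma> * (v i * s k i)"
          unfolding y(2)[OF SI[OF i]] clip_def by linarith
        then show "1 / v i * (y (Suc k) i - y k i) \<le> \<gamma> * s k i"
          using v[OF SI[OF i]] by (simp add: field_simps)
      qed
      moreover have "(\<Sum>i\<in>S. \<gamma> * s k i) = sum (s k) S * (real (Suc k) * \<gamma> - real k * \<gamma>)"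
        by (simp add: sum_distrib_left algebra_simps)
      ultimately have "(\<Sum>i\<in>S. 1 / v i * (y (Suc k) i - y k i))
          \<le> (\<Sum>i\<in>S. 1 / v i * (x (real (Suc k) * \<gamma>) i - x (real k * \<gamma>) i))" by linarith
      then have "(\<Sum>i\<in>S. 1 / v i * (y (Suc k) i - x (real (Suc k) * \<gamma>) i)) / \<gamma>
          \<le> (\<Sum>i\<in>S. 1 / v i * (y k i - x (real k * \<gamma>) i)) / \<gamma>"
        using \<open>\<gamma> > 0\<close> by (intro divide_right_mono) (auto simp: right_diff_distrib sum_subtractf)
      then show ?thesis by (simp only: e_def sum_divide_distrib times_divide_eq_right)
    qed
  qed (use assms in auto)
  then show ?thesis using \<open>\<gamma> > 0\<close> by (simp add: e_def pos_divide_le_eq mult.commute)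
qed

text \<open>The one-sided bound is applied to the evolutions and to their reflections, for which the
  total rate is \<open>- c\<close>.\<close>

lemma discrete_continuous_dist_le:
  fixes x :: "real \<Rightarrow> 'i \<Rightarrow> real" and y s :: "nat \<Rightarrow> 'i \<Rightarrow> real" and v :: "'i \<Rightarrow> real"
  assumes "finite I" "\<gamma> > 0" and v: "\<And>i. i \<in> I \<Longrightarrow> 1 \<le> v i \<and> v i \<le> V" and "0 < V" "0 \<le> L"
    and init: "\<And>i. i \<in> I \<Longrightarrow> \<bar>y 0 i - x 0 i\<bar> \<le> \<gamma>"
    and y: "\<And>k i. i \<in> I \<Longrightarrow> y k i \<in> {0..1}"
      "\<And>k i. i \<in> I \<Longrightarrow> y (Suc k) i = clip (y k i + \<gamma> * (v i * s k i))"
      "\<And>k. \<exists>q. rates I c (y k) q (s k)"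
    and x: "\<And>t i. i \<in> I \<Longrightarrow> 0 \<le> t \<Longrightarrow> x t i \<in> {0..1}"
      "\<And>i. i \<in> I \<Longrightarrow> L-lipschitz_on {0..} (\<lambda>t. x t i)"
      "AE t in lborel. 0 < t \<longrightarrow> (\<exists>q r. rates I c (x t) q r \<and>
        (\<forall>i\<in>I. ((\<lambda>t. x t i) has_real_derivative confined (x t i) (v i * r i)) (at t)))"
    and "i \<in> I"
  shows "\<bar>y k i - x (real k * \<gamma>) i\<bar> \<le> \<gamma> * (2 * (V * ((V + L) * card I * V + (L + 1))) * card I + V + 1)"
proof -
  have init': "y 0 i - x 0 i \<le> \<gamma>" "(1 - y 0 i) - (1 - x 0 i) \<le> \<gamma>" if "i \<in> I" for i
    using init[OF that] by (auto simp: abs_le_iff)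
  have "y k i - x (real k * \<gamma>) i \<le> \<gamma> * (2 * (V * ((V + L) * card I * V + (L + 1))) * card I + V + 1)"
    by (rule discrete_minus_continuous_le[where x = x and y = y and s = s, OF assms(1-5) init'(1) y x \<open>i \<in> I\<close>])
  moreover have "(1 - y k i) - (1 - x (real k * \<gamma>) i)
      \<le> \<gamma> * (2 * (V * ((V + L) * card I * V + (L + 1))) * card I + V + 1)"
  proof (rule discrete_minus_continuous_le[where I = I and v = v and c = "- c"
        and y = "\<lambda>k i. 1 - y k i" and x = "\<lambda>t i. 1 - x t i" and s = "\<lambda>k i. - s k i"])
    show "1 - y (Suc k) i = clip (1 - y k i + \<gamma> * (v i * - s k i))" if "i \<in> I" for k i
      unfolding y(2)[OF that] clip_reflect by (simp add: algebra_simps)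
    show "\<exists>q. rates I (- c) (\<lambda>i. 1 - y k i) q (\<lambda>i. - s k i)" for k
      using y(3)[of k] rates_reflect by blast
    show "L-lipschitz_on {0..} (\<lambda>t. 1 - x t i)" if "i \<in> I" for i
      using x(2)[OF that] by (auto simp: lipschitz_on_def dist_real_def abs_minus_commute)
    show "AE t in lborel. 0 < t \<longrightarrow> (\<exists>q r. rates I (- c) (\<lambda>i. 1 - x t i) q r \<and>
        (\<forall>i\<in>I. ((\<lambda>t. 1 - x t i) has_real_derivative confined (1 - x t i) (v i * r i)) (at t)))"
      using x(3)
    proof eventually_elim
      case (elim t)
      show ?case
      proof
        assume "0 < t"
        then obtain q r where r: "rates I c (x t) q r"
          "\<forall>i\<in>I. ((\<lambda>t. x t i) has_real_derivative confined (x t i) (v i * r i)) (at t)"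
          using elim by blast
        have "((\<lambda>t. 1 - x t i) has_real_derivative confined (1 - x t i) (v i * - r i)) (at t)"
          if "i \<in> I" for i
        proof -
          have "((\<lambda>t. 1 - x t i) has_real_derivative 0 - confined (x t i) (v i * r i)) (at t)"
            using r(2) that by (intro DERIV_diff DERIV_const) auto
          then show ?thesis using confined_reflect[of "x t i" "v i * r i"] by simp
        qed
        then show "\<exists>q r. rates I (- c) (\<lambda>i. 1 - x t i) q r \<and>
            (\<forall>i\<in>I. ((\<lambda>t. 1 - x t i) has_real_derivative confined (1 - x t i) (v i * r i)) (at t))"
          using rates_reflect[OF r(1)] by blast
      qed
    qed
  qed (use assms(1-5) init'(2) y(1) x(1) \<open>i \<in> I\<close> in auto)
  ultimately show ?thesis by (simp add: abs_le_iff)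
qed

section \<open>Uniform bounds for the ordered bids and the price\<close>

theorem theorem6p9:
  fixes \<nu>m \<nu>p :: nat and p :: real and B :: bids
    and X :: "real \<Rightarrow> bids" and D :: "real \<Rightarrow> nat \<Rightarrow> bids"
  assumes "0 < \<nu>m" and "\<nu>m < \<nu>p"
    and "bid_velocity_multiset \<nu>m \<nu>p B"
    and "p \<in> {0..1}" and "p * real (length B) \<in> \<nat>"
    and "continuous_evolution \<nu>m \<nu>p p B X"
    and "\<And>\<gamma>. \<gamma> \<in> step_sizes \<Longrightarrow> discrete_evolution (num_winners p B) \<gamma> B (D \<gamma>)"
  shows "(\<forall>i \<in> {1..length B}.
            (SUP \<gamma> \<in> step_sizes. SUP t \<in> {0..}.
               ereal (1 / \<gamma> * \<bar>nth_bid (rescaled \<gamma> (D \<gamma>) t) i - nth_bid (X t) i\<bar>)) < \<infinity>)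
       \<and> (SUP \<gamma> \<in> step_sizes. SUP t \<in> {0..}.
            ereal (1 / \<gamma> * \<bar>nth_bid (rescaled \<gamma> (D \<gamma>) t) (num_winners p B) - price p (X t)\<bar>)) < \<infinity>"
proof -
  define n where "n = length B"
  define m where "m = num_winners p B"
  define v where "v i = real (snd (B ! i))" for i
  define x where "x t i = fst (X t ! i)" for t i
  have B: "B \<noteq> []" "sorted (map fst B)" using assms(3) by (auto simp: bid_velocity_multiset_def)
  have "fst (B ! i) \<in> {0..1} \<and> snd (B ! i) \<in> {\<nu>m, \<nu>p}" if "i < n" for i
    using assms(3) nth_mem[of i B] that unfolding bid_velocity_multiset_def n_def
    by (metis (no_types, lifting) case_prod_beta)
  then have B01: "\<And>i. i < n \<Longrightarrow> fst (B ! i) \<in> {0..1}" and Bv: "\<And>i. i < n \<Longrightarrow> snd (B ! i) \<in> {\<nu>m, \<nu>p}"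
    by blast+
  have v: "1 \<le> v i \<and> v i \<le> real \<nu>p" if "i < n" for i
    using Bv[OF that] assms(1,2) by (auto simp: v_def)
  \<comment> \<open>The floor in \<open>num_winners\<close> is exact because \<open>np\<close> is a
    natural number.\<close>
  have pm: "p * real n = real m"
    using assms(5) by (auto simp: m_def num_winners_def n_def elim!: Nats_cases)
  then have "m \<le> n"
    using assms(4) mult_right_mono[of p 1 "real n"] by simp
  have X0: "X 0 = B" and snd_X: "\<And>t. 0 \<le> t \<Longrightarrow> map snd (X t) = map snd B"
    and X01: "\<And>t. 0 \<le> t \<Longrightarrow> fst ` set (X t) \<subseteq> {0..1}"
    and lip: "\<forall>i<n. \<exists>C. C-lipschitz_on {0..} (\<lambda>t. x t i)"
    and der: "AE t in lborel. 0 < t \<longrightarrow> (\<forall>i<n. ((\<lambda>s. x s i) has_real_derivative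
       confined (x t i) (bid_velocity \<nu>m \<nu>p p (X t) (fst (X t ! i)) (snd (X t ! i)))) (at t))"
    using assms(6) by (auto simp: continuous_evolution_def n_def x_def elim: AE_mp)
  have len: "length (X t) = n" and snd_nth: "\<And>i. i < n \<Longrightarrow> snd (X t ! i) = snd (B ! i)"
    and x01: "\<And>i. i < n \<Longrightarrow> x t i \<in> {0..1}" if "0 \<le> t" for t
  proof -
    show len: "length (X t) = n" using snd_X[OF that] by (metis length_map n_def)
    show "snd (X t ! i) = snd (B ! i)" if "i < n" for i
      using snd_X[OF \<open>0 \<le> t\<close>] len that by (metis n_def nth_map)
    show "x t i \<in> {0..1}" if "i < n" for i
      using X01[OF \<open>0 \<le> t\<close>] len that by (auto simp: x_def image_subset_iff)
  qed
  obtain C where C: "\<And>i. i < n \<Longrightarrow> (C i)-lipschitz_on {0..} (\<lambda>t. x t i)" using lip by metis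
  \<comment> \<open>A common Lipschitz constant for all bidders; it depends on \<open>X\<close> but
    not on \<open>\<gamma>\<close>.\<close>
  define L where "L = (\<Sum>i<n. C i)"
  have C0: "0 \<le> C i" if "i < n" for i using C[OF that] by (rule lipschitz_on_nonneg)
  then have "0 \<le> L" by (auto simp: L_def intro: sum_nonneg)
  have L: "L-lipschitz_on {0..} (\<lambda>t. x t i)" if "i < n" for i
    using C[OF that] by (rule lipschitz_on_le) (use C0 that in \<open>auto simp: L_def intro: member_le_sum\<close>)
  have flow: "AE t in lborel. 0 < t \<longrightarrow> (\<exists>q r. rates {..<n} (2 * real m - real n) (x t) q r \<and>
        (\<forall>i\<in>{..<n}. ((\<lambda>t. x t i) has_real_derivative confined (x t i) (v i * r i)) (at t)))"
    using der
  proof eventually_elim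
    case (elim t)
    show ?case
    proof
      assume "0 < t"
      then have t: "0 \<le> t" by simp
      define r where "r i = bid_velocity \<nu>m \<nu>p p (X t) (fst (X t ! i)) (snd (X t ! i)) / real (snd (X t ! i))" for i
      have "X t \<noteq> []" using len[OF t] B(1) by (auto simp: n_def)
      have vel: "snd (X t ! i) \<in> {\<nu>m, \<nu>p}" and nonneg: "0 \<le> fst (X t ! i)" if "i < n" for i
        using Bv snd_nth[OF t] x01[OF t] that by (auto simp: x_def)
      note bal = bid_velocity_balance[of \<nu>m \<nu>p "X t" m p, unfolded len[OF t],
        OF assms(1,2) \<open>X t \<noteq> []\<close> \<open>m \<le> n\<close> pm nonneg vel, folded r_def x_def]
      have "rates {..<n} (2 * real m - real n) (x t) (price p (X t)) r"
        unfolding rates_def by (intro conjI ballI impI) (simp_all only: lessThan_iff bal)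
      moreover have "v i * r i = bid_velocity \<nu>m \<nu>p p (X t) (fst (X t ! i)) (snd (X t ! i))" if "i < n" for i
        using v[OF that] snd_nth[OF t that] by (simp add: r_def v_def)
      ultimately show "\<exists>q r. rates {..<n} (2 * real m - real n) (x t) q r \<and>
        (\<forall>i\<in>{..<n}. ((\<lambda>t. x t i) has_real_derivative confined (x t i) (v i * r i)) (at t))"
        using elim \<open>0 < t\<close> by (intro exI[of _ "price p (X t)"] exI[of _ r]) auto
    qed
  qed
  \<comment> \<open>The comparison constant for \<open>V = \<nu>p\<close> and \<open>n\<close>
    bidders, free of \<open>\<gamma>\<close> and \<open>t\<close>.\<close>
  define M where "M = 2 * (real \<nu>p * ((real \<nu>p + L) * real n * real \<nu>p + (L + 1))) * real n + real \<nu>p + 1"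
  have "0 \<le> M" using \<open>0 \<le> L\<close> by (simp add: M_def)
  \<comment> \<open>\<open>M\<close> is the error at grid times, and \<open>L\<close> accounts for
    the motion of \<open>X\<close> between the last grid time and \<open>t\<close>. The index 0 is
    included since the price is the bid of index \<open>m\<close>, which may be 0.\<close>
  have bound: "1 / \<gamma> * \<bar>nth_bid (rescaled \<gamma> (D \<gamma>) t) i - nth_bid (X t) i\<bar> \<le> M + L"
    if \<gamma>: "\<gamma> \<in> step_sizes" and "0 \<le> t" "i \<le> n" for \<gamma> t i
  proof -
    have \<gamma>0: "\<gamma> > 0" using \<gamma> by (auto simp: step_sizes_def)
    obtain y s where y: "\<And>i. i < n \<Longrightarrow> y 0 i = \<gamma> * of_int \<lfloor>fst (B ! i) / \<gamma>\<rfloor>"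
      "\<And>k i. i < n \<Longrightarrow> y (Suc k) i = clip (y k i + \<gamma> * (v i * s k i))"
      "\<And>k i. i < n \<Longrightarrow> y k i \<in> {0..1}"
      "\<And>k i. i < n \<Longrightarrow> \<bar>s k i\<bar> = 1"
      "\<And>k. (\<Sum>i<n. s k i) = 2 * real m - real n"
      "\<And>k i. i < n \<Longrightarrow> y k i < nth_bid (D \<gamma> k) m \<Longrightarrow> s k i = 1"
      "\<And>k i. i < n \<Longrightarrow> nth_bid (D \<gamma> k) m < y k i \<Longrightarrow> s k i = -1"
      "\<And>k. mset (map fst (D \<gamma> k)) = mset (map (y k) [0..<n])"
      using discrete_evolution_labelling[of m \<gamma> B "D \<gamma>"] assms(7)[OF \<gamma>] \<open>m \<le> n\<close> \<gamma>0 B(2) B01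
      unfolding n_def m_def v_def by blast
    define k where "k = nat \<lfloor>t / \<gamma>\<rfloor>"
    have "0 \<le> t / \<gamma>" using \<open>0 \<le> t\<close> \<gamma>0 by simp
    then have "real k = of_int \<lfloor>t / \<gamma>\<rfloor>" by (simp add: k_def)
    then have "real k \<le> t / \<gamma>" "t / \<gamma> < real k + 1" by linarith+
    then have k: "real k * \<gamma> \<le> t" "t \<le> real k * \<gamma> + \<gamma>" using \<gamma>0 by (auto simp: field_simps)
    have "\<bar>y k j - x t j\<bar> \<le> \<gamma> * (M + L)" if j: "j < n" for j
    proof -
      have init: "\<bar>y 0 j - x 0 j\<bar> \<le> \<gamma>" if "j \<in> {..<n}" for j
      proof -
        have "\<bar>of_int \<lfloor>fst (B ! j) / \<gamma>\<rfloor> - fst (B ! j) / \<gamma>\<bar> \<le> 1" by linarith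
        then have "\<gamma> * \<bar>of_int \<lfloor>fst (B ! j) / \<gamma>\<rfloor> - fst (B ! j) / \<gamma>\<bar> \<le> \<gamma>" using \<gamma>0 by simp
        then have "\<bar>\<gamma> * (of_int \<lfloor>fst (B ! j) / \<gamma>\<rfloor> - fst (B ! j) / \<gamma>)\<bar> \<le> \<gamma>" using \<gamma>0 by (simp add: abs_mult)
        then show ?thesis using y(1)[of j] that \<gamma>0 by (simp add: x_def X0 right_diff_distrib)
      qed
      have rt: "\<exists>q. rates {..<n} (2 * real m - real n) (y k) q (s k)" for k
        using y(4)[of _ k] y(6,7)[of _ k] y(5)[of k] by (intro exI[of _ "nth_bid (D \<gamma> k) m"]) (auto simp: rates_def)
      have "\<bar>y k j - x (real k * \<gamma>) j\<bar> \<le> \<gamma> * M"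
        using discrete_continuous_dist_le[where I = "{..<n}" and \<gamma> = \<gamma> and v = v and V = "real \<nu>p" and L = L
            and y = y and x = x and s = s and c = "2 * real m - real n" and i = j and k = k,
            OF _ \<gamma>0 _ _ \<open>0 \<le> L\<close> init _ _ rt _ _ flow]
          v y(2,3) x01 L assms(1,2) j by (simp add: M_def)
      moreover have "\<bar>x t j - x (real k * \<gamma>) j\<bar> \<le> L * \<gamma>"
      proof -
        have "\<bar>x t j - x (real k * \<gamma>) j\<bar> \<le> L * \<bar>t - real k * \<gamma>\<bar>"
          using lipschitz_onD[OF L[OF j], of t "real k * \<gamma>"] \<open>0 \<le> t\<close> \<gamma>0 by (simp add: dist_real_def)
        also have "\<dots> \<le> L * \<gamma>" using k \<open>0 \<le> L\<close> by (intro mult_left_mono) auto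
        finally show ?thesis .
      qed
      moreover have "\<gamma> * (M + L) = \<gamma> * M + L * \<gamma>" by (simp add: algebra_simps)
      ultimately show ?thesis by linarith
    qed
    moreover have "map fst (X t) = map (x t) [0..<n]"
      using len[OF \<open>0 \<le> t\<close>] by (auto simp: x_def intro: nth_equalityI)
    ultimately have "\<bar>nth_bid (D \<gamma> k) i - nth_bid (X t) i\<bar> \<le> \<gamma> * (M + L)"
      using y(8) \<open>i \<le> n\<close> \<open>0 \<le> M\<close> \<open>0 \<le> L\<close> \<gamma>0
      by (intro nth_bid_diff_le[where n = n and y = "y k" and x = "x t"]) auto
    then show ?thesis using \<gamma>0 by (simp add: rescaled_def k_def pos_divide_le_eq mult.commute)
  qed
  have price: "price p (X t) = nth_bid (X t) m" if "0 \<le> t" for t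
    using len[OF that] x01[OF that] B(1) \<open>m \<le> n\<close> pm by (intro price_eq_nth_bid) (auto simp: n_def x_def)
  have SUP: "(SUP \<gamma> \<in> step_sizes. SUP t \<in> {0..}. ereal (f \<gamma> t)) < \<infinity>"
    if "\<And>\<gamma> t. \<gamma> \<in> step_sizes \<Longrightarrow> 0 \<le> t \<Longrightarrow> f \<gamma> t \<le> M + L" for f :: "real \<Rightarrow> real \<Rightarrow> real"
  proof -
    have "(SUP \<gamma> \<in> step_sizes. SUP t \<in> {0..}. ereal (f \<gamma> t)) \<le> ereal (M + L)"
      using that by (intro SUP_least) auto
    then show ?thesis by (rule order.strict_trans1) simp
  qed
  show ?thesis
    using bound \<open>m \<le> n\<close> price unfolding n_def m_def by (intro conjI ballI SUP) auto
qed

end
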